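(* Let $G$ be a group. Then $\mathcal{P}(G)$ is maximal planar if and only if $G$ is a cyclic group of order at most four.
   Context: The power graph $\mathcal{P}(G)$ of a group $G$ is the simple graph with vertex set $G$ in which two distinct vertices $x,y$ are adjacent if and only if $x\in\langle y\rangle$ or $y\in\langle x\rangle$. A simple graph is maximal planar if it is planar but the graph obtained by adding any new edge (between two nonadjacent distinct vertices) is not planar. *)

theory Defs
  imports "HOL-Analysis.Analysis" "HOL-Algebra.Elementary_Groups"
begin

text \<open>A simple graph is given by its vertex set and its set of edges, where an edge is the
  two-element set of its end vertices.\<close>

definition simple_graph :: "'a set \<Rightarrow> 'a set set \<Rightarrow> bool" where
  "simple_graph V E \<longleftrightarrow> (\<forall>e\<in>E. e \<subseteq> V \<and> card e = 2)"

definition power_graph_edges :: "('a, 'b) monoid_scheme \<Rightarrow> 'a set set" where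
  "power_graph_edges G =
     {{x, y} | x y. x \<in> carrier G \<and> y \<in> carrier G \<and> x \<noteq> y \<and>
                    (x \<in> generate G {y} \<or> y \<in> generate G {x})}"

lemma simple_graph_power_graph: "simple_graph (carrier G) (power_graph_edges G)"
  by (auto simp: simple_graph_def power_graph_edges_def)

text \<open>The plane is \<^typ>\<open>complex\<close>.  A drawing places the vertices at distinct points and represents
  every edge by an arc that joins the points of its two end vertices, passes through no other vertex
  point, and meets the other edges only in vertex points (hence only in those of common end
  vertices).  The vertex set may be infinite, of any cardinality, and no local finiteness or
  closedness is required of the drawing.\<close>

definition plane_drawing ::
    "'a set \<Rightarrow> 'a set set \<Rightarrow> ('a \<Rightarrow> complex) \<Rightarrow> ('a set \<Rightarrow> real \<Rightarrow> complex) \<Rightarrow> bool" where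
  "plane_drawing V E p c \<longleftrightarrow>
     inj_on p V \<and>
     (\<forall>e\<in>E. arc (c e) \<and> {pathstart (c e), pathfinish (c e)} = p ` e \<and>
            path_image (c e) \<inter> p ` V = p ` e) \<and>
     (\<forall>e\<in>E. \<forall>f\<in>E. e \<noteq> f \<longrightarrow> path_image (c e) \<inter> path_image (c f) \<subseteq> p ` V)"

definition planar :: "'a set \<Rightarrow> 'a set set \<Rightarrow> bool" where
  "planar V E \<longleftrightarrow> simple_graph V E \<and> (\<exists>p c. plane_drawing V E p c)"

definition maximal_planar :: "'a set \<Rightarrow> 'a set set \<Rightarrow> bool" where
  "maximal_planar V E \<longleftrightarrow>
     planar V E \<and>
     (\<forall>x\<in>V. \<forall>y\<in>V. x \<noteq> y \<longrightarrow> {x, y} \<notin> E \<longrightarrow> \<not> planar V (insert {x, y} E))"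

end

theory Submission
  imports Defs "HOL-Complex_Analysis.Contour_Integration" "HOL-Algebra.Multiplicative_Group"
begin

text \<open>If \<open>P(G)\<close> is planar then it contains no \<open>K\<^sub>5\<close>, which forces every element order to be at most \<open>4\<close>.
  Moreover \<open>G\<close> has at most continuum many elements, and only countably many of order \<open>4\<close>: such an
  \<open>x\<close> spans a triangle \<open>x, x\<^sup>-\<^sup>1, x\<^sup>2\<close>, and for distinct triangles the sides not containing
  the identity are disjoint open sets. Conversely, this information suffices to draw \<open>P(G)\<close>
  afresh: the nonidentity elements go to the real line, edges between them are semicircles in the
  upper half-plane, and the edges at the identity are segments to \<open>-\<i>\<close>. Two elements of order \<open>3\<close>, two
  involutions, or two elements of order \<open>4\<close> with a common square can be placed such that there is
  room for an additional edge. So a maximal planar \<open>P(G)\<close> leaves only the groups in which there is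
  nothing to add.\<close>

subsection \<open>Jordan curves in plane drawings\<close>

text \<open>The given drawing can be wild: vertices and edges may accumulate, so there need not be a
  face into which a missing edge could be put. Hence nothing of it is kept except bounds on orders
  and cardinalities. Countability matters for order 4 only: the triangles over different involutions
  get disjoint intervals of the line, whereas the edges between elements of order 3 become nested
  semicircles, of which there may be continuum many, and an involution that is no square is isolated
  once the identity is removed. The identity is adjacent to everything; therefore it can serve as
  apex of the new drawing, and it also singles out the empty side of each triangle. Nonplanarity of
  \<open>K5\<close> is derived from the Jordan curve theorem by cutting along theta graphs, and an
  inversion moves a vertex from the outside of a triangle to its inside. One configuration is
  excluded by algebra instead of drawing: a unique involution is central, so together with an
  element of order 3 it would give an element of order 6.\<close>

locale plane_graph =
  fixes V :: "'a set" and E :: "'a set set" and p :: "'a \<Rightarrow> complex" and c :: "'a set \<Rightarrow> real \<Rightarrow> complex"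
  assumes simple: "simple_graph V E" and drawing: "plane_drawing V E p c"
begin

definition pts :: "'a set set \<Rightarrow> complex set" where
  "pts F = (\<Union>f\<in>F. path_image (c f))"

lemma pts_insert: "pts (insert f F) = path_image (c f) \<union> pts F"
  and pts_empty: "pts {} = {}"
  by (auto simp: pts_def)

lemma inj_p: "inj_on p V"
  using drawing by (simp add: plane_drawing_def)

lemma edge_subset: "f \<in> E \<Longrightarrow> f \<subseteq> V"
  using simple by (auto simp: simple_graph_def)

lemma edge_neq: "{x, y} \<in> E \<Longrightarrow> x \<noteq> y"
  using simple by (auto simp: simple_graph_def)

lemma edge_ends: "{x, y} \<in> E \<Longrightarrow> x \<in> V" "{x, y} \<in> E \<Longrightarrow> y \<in> V"
  using edge_subset by blast+

lemma edge_vertices: "f \<in> E \<Longrightarrow> path_image (c f) \<inter> p ` V = p ` f"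
  using drawing by (simp add: plane_drawing_def)

lemma edges_meet: "\<lbrakk>f \<in> E; g \<in> E; f \<noteq> g\<rbrakk> \<Longrightarrow> path_image (c f) \<inter> path_image (c g) \<subseteq> p ` V"
  using drawing by (simp add: plane_drawing_def)

lemma pts_vertex: "\<lbrakk>F \<subseteq> E; x \<in> V\<rbrakk> \<Longrightarrow> p x \<in> pts F \<longleftrightarrow> x \<in> \<Union>F"
proof
  assume F: "F \<subseteq> E" and x: "x \<in> V" and "p x \<in> pts F"
  then obtain f where f: "f \<in> F" "p x \<in> path_image (c f)" by (auto simp: pts_def)
  then have "p x \<in> p ` f" using edge_vertices[of f] F x by blast
  then show "x \<in> \<Union>F"
    using f F x edge_subset[of f] inj_p by (auto dest: inj_onD)
next
  assume F: "F \<subseteq> E" and "x \<in> \<Union>F"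
  then obtain f where "f \<in> F" "x \<in> f" by blast
  then show "p x \<in> pts F"
    using edge_vertices[of f] F unfolding pts_def by blast
qed

text \<open>Turns every later intersection of curves into a computation with vertex sets: arcs of
  different edges meet only in vertex points, and a vertex point lies on exactly the edges that
  contain the vertex.\<close>

lemma pts_Int:
  assumes "F \<subseteq> E" "F' \<subseteq> E" "F \<inter> F' = {}"
  shows "pts F \<inter> pts F' = p ` (\<Union>F \<inter> \<Union>F')"
proof
  show "pts F \<inter> pts F' \<subseteq> p ` (\<Union>F \<inter> \<Union>F')"
  proof
    fix q assume q: "q \<in> pts F \<inter> pts F'"
    then obtain f f' where "f \<in> F" "f' \<in> F'" "q \<in> path_image (c f) \<inter> path_image (c f')"
      by (auto simp: pts_def)
    with edges_meet[of f f'] assms have "q \<in> p ` V" by blast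
    then obtain v where "v \<in> V" "q = p v" by blast
    with q show "q \<in> p ` (\<Union>F \<inter> \<Union>F')"
      using pts_vertex[OF assms(1)] pts_vertex[OF assms(2)] by auto
  qed
  have "\<Union>F \<subseteq> V" using assms edge_subset by blast
  then show "p ` (\<Union>F \<inter> \<Union>F') \<subseteq> pts F \<inter> pts F'"
    using pts_vertex[OF assms(1)] pts_vertex[OF assms(2)] by auto
qed

text \<open>A drawing fixes the ends of an arc only as a set; the arc is reversed when it runs the
  other way.\<close>

lemma obtain_edge_arc:
  assumes "{x, y} \<in> E"
  obtains g where "arc g" "pathstart g = p x" "pathfinish g = p y" "path_image g = pts {{x, y}}"
proof -
  have a: "arc (c {x, y})" and e: "{pathstart (c {x, y}), pathfinish (c {x, y})} = {p x, p y}"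
    using assms drawing by (auto simp: plane_drawing_def)
  from e consider "pathstart (c {x, y}) = p x" "pathfinish (c {x, y}) = p y"
    | "pathstart (c {x, y}) = p y" "pathfinish (c {x, y}) = p x"
    by (auto simp: doubleton_eq_iff)
  then show thesis
  proof cases
    case 1
    then show thesis using that[of "c {x, y}"] a by (simp add: pts_def)
  next
    case 2
    then show thesis using that[of "reversepath (c {x, y})"] a
      by (simp add: pts_def arc_reversepath)
  qed
qed

lemma obtain_path_arc:
  assumes "{x, y} \<in> E" "{y, z} \<in> E" "x \<noteq> z"
  obtains g where "arc g" "pathstart g = p x" "pathfinish g = p z"
    "path_image g = pts {{x, y}, {y, z}}"
proof -
  obtain g where g: "arc g" "pathstart g = p x" "pathfinish g = p y" "path_image g = pts {{x, y}}"
    using obtain_edge_arc assms by blast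
  obtain h where h: "arc h" "pathstart h = p y" "pathfinish h = p z" "path_image h = pts {{y, z}}"
    using obtain_edge_arc assms by blast
  have "x \<noteq> y" "y \<noteq> z" using assms edge_neq by auto
  have "pts {{x, y}} \<inter> pts {{y, z}} = p ` (\<Union>{{x, y}} \<inter> \<Union>{{y, z}})"
    using assms by (intro pts_Int) (auto simp: doubleton_eq_iff)
  also have "\<Union>{{x, y}} \<inter> \<Union>{{y, z}} = {y}"
    using assms(3) \<open>x \<noteq> y\<close> by auto
  finally have "path_image g \<inter> path_image h \<subseteq> {pathstart h}"
    using g h by simp
  then have "arc (g +++ h)" using g h by (intro arc_join) auto
  then show thesis
    using g h by (intro that[of "g +++ h"]) (auto simp: path_image_join pts_insert pts_empty)
qed

lemma obtain_triangle_loop: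
  assumes "{x, y} \<in> E" "{y, z} \<in> E" "{x, z} \<in> E"
  obtains g where "simple_path g" "pathfinish g = pathstart g"
    "path_image g = pts {{x, y}, {y, z}, {x, z}}"
proof -
  have n: "x \<noteq> y" "y \<noteq> z" "x \<noteq> z" using assms edge_neq by auto
  obtain g where g: "arc g" "pathstart g = p x" "pathfinish g = p z" "path_image g = pts {{x, y}, {y, z}}"
    using obtain_path_arc[OF assms(1,2)] n by blast
  obtain h where h: "arc h" "pathstart h = p z" "pathfinish h = p x" "path_image h = pts {{z, x}}"
    using obtain_edge_arc[of z x] assms by (auto simp: insert_commute)
  have "pts {{x, y}, {y, z}} \<inter> pts {{z, x}} = p ` (\<Union>{{x, y}, {y, z}} \<inter> \<Union>{{z, x}})"
    using assms n by (intro pts_Int) (auto simp: doubleton_eq_iff insert_commute)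
  also have "\<Union>{{x, y}, {y, z}} \<inter> \<Union>{{z, x}} = {x, z}"
    using n by auto
  finally have "path_image g \<inter> path_image h \<subseteq> {pathstart g, pathstart h}"
    using g h by simp
  then have "simple_path (g +++ h)" using g h by (intro simple_path_join_loop) auto
  then show thesis
    using g h by (intro that[of "g +++ h"]) (auto simp: path_image_join pts_insert pts_empty insert_commute)
qed

text \<open>For edges whose end \<open>y\<close> lies on a closed curve: the rest of the edge, the
  image of \<open>{0..<1}\<close>, is still connected and so stays on one side.\<close>

lemma connected_half_edge:
  assumes "{x, y} \<in> E"
  shows "connected (pts {{x, y}} - {p y})"
proof -
  obtain g where g: "arc g" "pathstart g = p x" "pathfinish g = p y" "path_image g = pts {{x, y}}"
    using obtain_edge_arc assms by blast
  have inj: "inj_on g {0..1}" using g by (simp add: arc_def)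
  have "path_image g - {pathfinish g} = g ` {0..<1}"
  proof (intro equalityI subsetI)
    fix q assume "q \<in> path_image g - {pathfinish g}"
    then obtain t where "t \<in> {0..1}" "q = g t" "t \<noteq> 1"
      unfolding path_image_def pathfinish_def by blast
    then show "q \<in> g ` {0..<1}" by force
  next
    fix q assume "q \<in> g ` {0..<1}"
    then obtain t where t: "t \<in> {0..<1}" "q = g t" by blast
    then have "g t \<noteq> g 1" using inj_on_eq_iff[OF inj, of t 1] by auto
    with t show "q \<in> path_image g - {pathfinish g}" by (auto simp: path_image_def pathfinish_def)
  qed
  moreover have "connected (g ` {0..<1})"
  proof (rule connected_continuous_image)
    show "continuous_on {0..<1} g"
      using g(1) by (auto simp: arc_def path_def intro: continuous_on_subset[of "{0..1}"])
  qed simp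
  ultimately show ?thesis using g by simp
qed

lemma half_edge_same_side:
  assumes "{x, y} \<in> E" "F \<subseteq> E" "x \<notin> \<Union>F" "q \<in> pts {{x, y}} - {p y}"
  shows "connected_component (- pts F) (p x) q"
proof (rule connected_componentI[of "pts {{x, y}} - {p y}"])
  have "pts {{x, y}} \<inter> pts F = p ` (\<Union>{{x, y}} \<inter> \<Union>F)"
    using assms by (intro pts_Int) auto
  then show "pts {{x, y}} - {p y} \<subseteq> - pts F"
    using assms(3) by auto
  have "x \<in> V" "y \<in> V" "x \<noteq> y" using assms(1) edge_ends edge_neq by auto
  moreover have "p x \<noteq> p y" using calculation inj_on_eq_iff[OF inj_p] by blast
  moreover have "p x \<in> pts {{x, y}}" using assms(1) pts_vertex[of "{{x, y}}" x] calculation by simp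
  ultimately show "p x \<in> pts {{x, y}} - {p y}" by blast
qed (use assms(4) connected_half_edge[OF assms(1)] in blast)+

lemma edge_same_side:
  assumes "{x, y} \<in> E" "F \<subseteq> E" "x \<notin> \<Union>F" "y \<notin> \<Union>F"
  shows "connected_component (- pts F) (p x) (p y)"
proof (rule connected_componentI[of "pts {{x, y}}"])
  have "pts {{x, y}} \<inter> pts F = p ` (\<Union>{{x, y}} \<inter> \<Union>F)"
    using assms by (intro pts_Int) auto
  then show "pts {{x, y}} \<subseteq> - pts F"
    using assms(3,4) by auto
  have "x \<in> V" "y \<in> V" using assms(1) edge_ends by auto
  then show "p x \<in> pts {{x, y}}" "p y \<in> pts {{x, y}}"
    using assms(1) pts_vertex[of "{{x, y}}"] by auto
  obtain g where "arc g" "path_image g = pts {{x, y}}"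
    using obtain_edge_arc assms by metis
  then show "connected (pts {{x, y}})" by (metis connected_arc_image)
qed

lemma obtain_inner_point:
  assumes "{x, y} \<in> E"
  obtains q where "q \<in> pts {{x, y}}" "q \<noteq> p x" "q \<noteq> p y"
proof -
  obtain g where g: "arc g" "pathstart g = p x" "pathfinish g = p y" "path_image g = pts {{x, y}}"
    using obtain_edge_arc assms by blast
  have "g (1/2) \<noteq> g 0" "g (1/2) \<noteq> g 1"
    using g(1) inj_onD[of g "{0..1}" "1/2" 0] inj_onD[of g "{0..1}" "1/2" 1]
    by (auto simp: arc_def)
  moreover have "g (1/2) \<in> path_image g" by (simp add: path_image_def)
  ultimately show thesis using g that[of "g (1/2)"] by (auto simp: pathstart_def pathfinish_def)
qed

section \<open>Theta graphs and the complete graph on five vertices\<close>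

lemma split_triangle:
  assumes E: "{x, y} \<in> E" "{x, t} \<in> E" "{t, y} \<in> E" "{x, u} \<in> E" "{u, y} \<in> E" and "u \<noteq> t"
    and u: "p u \<in> inside (pts {{x, y}, {t, y}, {x, t}})"
  shows "inside (pts {{x, y}, {t, y}, {x, t}}) =
    inside (pts {{x, y}, {x, u}, {u, y}}) \<union> inside (pts {{x, t}, {t, y}, {x, u}, {u, y}}) \<union>
    (pts {{x, u}, {u, y}} - {p x, p y})"
proof -
  have n: "x \<noteq> y" "x \<noteq> t" "t \<noteq> y" "x \<noteq> u" "u \<noteq> y" using E edge_neq by auto
  have V: "x \<in> V" "y \<in> V" "u \<in> V" using E edge_subset by auto
  obtain c1 where c1: "arc c1" "pathstart c1 = p x" "pathfinish c1 = p y" "path_image c1 = pts {{x, y}}"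
    using obtain_edge_arc E by blast
  obtain c2 where c2: "arc c2" "pathstart c2 = p x" "pathfinish c2 = p y"
      "path_image c2 = pts {{x, t}, {t, y}}"
    using obtain_path_arc E n by blast
  obtain c3 where c3: "arc c3" "pathstart c3 = p x" "pathfinish c3 = p y"
      "path_image c3 = pts {{x, u}, {u, y}}"
    using obtain_path_arc E n by blast
  have eq: "pts {{x, y}} \<union> pts {{x, t}, {t, y}} = pts {{x, y}, {t, y}, {x, t}}"
     "pts {{x, y}} \<union> pts {{x, u}, {u, y}} = pts {{x, y}, {x, u}, {u, y}}"
     "pts {{x, t}, {t, y}} \<union> pts {{x, u}, {u, y}} = pts {{x, t}, {t, y}, {x, u}, {u, y}}"
    by (auto simp: pts_insert)
  have i: "pts {{x, y}} \<inter> pts {{x, t}, {t, y}} = {p x, p y}"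
    by (subst pts_Int) (use E n \<open>u \<noteq> t\<close> in \<open>auto simp: doubleton_eq_iff\<close>)
  have ii: "pts {{x, y}} \<inter> pts {{x, u}, {u, y}} = {p x, p y}"
    by (subst pts_Int) (use E n \<open>u \<noteq> t\<close> in \<open>auto simp: doubleton_eq_iff\<close>)
  have iii: "pts {{x, t}, {t, y}} \<inter> pts {{x, u}, {u, y}} = {p x, p y}"
    by (subst pts_Int) (use E n \<open>u \<noteq> t\<close> in \<open>auto simp: doubleton_eq_iff\<close>)
  \<comment> \<open>The edge \<open>{x, y}\<close> and the paths over \<open>t\<close> and over
    \<open>u\<close> form a theta graph; \<open>u\<close> witnesses that the third arc is the chord
    through the inside.\<close>
  have ne: "pts {{x, u}, {u, y}} \<inter> inside (pts {{x, y}, {t, y}, {x, t}}) \<noteq> {}"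
    using u E V pts_vertex[of "{{x, u}, {u, y}}" u] by auto
  have "p x \<noteq> p y" using n V inj_onD[OF inj_p] by blast
  then show ?thesis
    using split_inside_simple_closed_curve[of c1 "p x" "p y" c2 c3] c1 c2 c3 i ii iii ne
    unfolding eq[symmetric]
    by (metis arc_imp_simple_path)
qed

text \<open>The cut that follows \<open>split_triangle\<close>: two paths from \<open>d\<close> to
  \<open>u\<close> and the edge \<open>{d, u}\<close> form a theta graph with this edge as chord.
  Both cuts together leave three triangles at \<open>u\<close>.\<close>

lemma split_quadrilateral:
  assumes E: "{d, a} \<in> E" "{a, u} \<in> E" "{d, b} \<in> E" "{b, u} \<in> E" "{d, u} \<in> E" and "a \<noteq> b"
    and ne: "pts {{d, u}} \<inter> inside (pts {{d, a}, {a, u}, {d, b}, {b, u}}) \<noteq> {}"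
  shows "inside (pts {{d, a}, {a, u}, {d, b}, {b, u}}) =
    inside (pts {{d, a}, {a, u}, {d, u}}) \<union> inside (pts {{d, b}, {b, u}, {d, u}}) \<union>
    (pts {{d, u}} - {p d, p u})"
proof -
  have n: "d \<noteq> a" "a \<noteq> u" "d \<noteq> b" "b \<noteq> u" "d \<noteq> u" using E edge_neq by auto
  have V: "d \<in> V" "u \<in> V" using E edge_subset by auto
  obtain c1 where c1: "arc c1" "pathstart c1 = p d" "pathfinish c1 = p u"
      "path_image c1 = pts {{d, a}, {a, u}}"
    using obtain_path_arc E n by blast
  obtain c2 where c2: "arc c2" "pathstart c2 = p d" "pathfinish c2 = p u"
      "path_image c2 = pts {{d, b}, {b, u}}"
    using obtain_path_arc E n by blast
  obtain c3 where c3: "arc c3" "pathstart c3 = p d" "pathfinish c3 = p u" "path_image c3 = pts {{d, u}}"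
    using obtain_edge_arc E by blast
  have eq: "pts {{d, a}, {a, u}} \<union> pts {{d, b}, {b, u}} = pts {{d, a}, {a, u}, {d, b}, {b, u}}"
     "pts {{d, a}, {a, u}} \<union> pts {{d, u}} = pts {{d, a}, {a, u}, {d, u}}"
     "pts {{d, b}, {b, u}} \<union> pts {{d, u}} = pts {{d, b}, {b, u}, {d, u}}"
    by (auto simp: pts_insert)
  have i: "pts {{d, a}, {a, u}} \<inter> pts {{d, b}, {b, u}} = {p d, p u}"
    by (subst pts_Int) (use E n \<open>a \<noteq> b\<close> in \<open>auto simp: doubleton_eq_iff\<close>)
  have ii: "pts {{d, a}, {a, u}} \<inter> pts {{d, u}} = {p d, p u}"
    by (subst pts_Int) (use E n \<open>a \<noteq> b\<close> in \<open>auto simp: doubleton_eq_iff\<close>)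
  have iii: "pts {{d, b}, {b, u}} \<inter> pts {{d, u}} = {p d, p u}"
    by (subst pts_Int) (use E n \<open>a \<noteq> b\<close> in \<open>auto simp: doubleton_eq_iff\<close>)
  have "p d \<noteq> p u" using n V inj_onD[OF inj_p] by blast
  then show ?thesis
    using split_inside_simple_closed_curve[of c1 "p d" "p u" c2 c3] c1 c2 c3 i ii iii ne
    unfolding eq[symmetric]
    by (metis arc_imp_simple_path)
qed

text \<open>The edges at \<open>u\<close> cut the triangle into three, and the edge
  \<open>{u, w}\<close> keeps \<open>w\<close> inside the large one. Each small triangle misses one
  of \<open>a\<close>, \<open>b\<close>, \<open>d\<close>, and the edge from \<open>w\<close> to
  that vertex would put a point of the large triangle into its own inside.\<close>

lemma no_K5_inside:
  assumes V: "a \<in> V" "b \<in> V" "d \<in> V" "u \<in> V" "w \<in> V"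
    and E: "{a, b} \<in> E" "{a, d} \<in> E" "{a, u} \<in> E" "{a, w} \<in> E" "{b, d} \<in> E"
      "{b, u} \<in> E" "{b, w} \<in> E" "{d, u} \<in> E" "{d, w} \<in> E" "{u, w} \<in> E"
    and u: "p u \<in> inside (pts {{a, b}, {d, b}, {a, d}})"
  shows False
proof -
  have n: "a \<noteq> b" "a \<noteq> d" "a \<noteq> u" "a \<noteq> w" "b \<noteq> d" "b \<noteq> u" "b \<noteq> w" "d \<noteq> u" "d \<noteq> w" "u \<noteq> w"
    using E edge_neq by auto
  have E': "{b, a} \<in> E" "{d, a} \<in> E" "{u, a} \<in> E" "{w, a} \<in> E" "{d, b} \<in> E"
      "{u, b} \<in> E" "{w, b} \<in> E" "{u, d} \<in> E" "{w, d} \<in> E" "{w, u} \<in> E"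
    using E by (simp_all add: insert_commute)
  let ?T = "pts {{a, b}, {d, b}, {a, d}}"
  let ?Q = "pts {{d, a}, {a, u}, {d, b}, {b, u}}"
  have T: "p a \<notin> inside ?T" "p b \<notin> inside ?T" "p d \<notin> inside ?T"
    using V E E' pts_vertex[of "{{a, b}, {d, b}, {a, d}}"] inside_no_overlap[of ?T] by blast+
  have Qeq: "pts {{a, d}, {d, b}, {a, u}, {u, b}} = ?Q"
    by (simp add: pts_insert insert_commute Un_ac)
  have split1: "inside ?T = inside (pts {{a, b}, {a, u}, {u, b}}) \<union> inside ?Q \<union>
    (pts {{a, u}, {u, b}} - {p a, p b})"
    using split_triangle[of a b d u] E E' n u Qeq by auto
  have w: "p w \<in> inside ?T"
    using inside_same_component[OF edge_same_side u, of w] E E' n by auto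
  moreover have "p w \<notin> pts {{a, u}, {u, b}}"
    using V E E' n pts_vertex[of "{{a, u}, {u, b}}" w] by auto
  moreover have "p w \<notin> inside (pts {{a, b}, {a, u}, {u, b}})"
  proof
    assume "p w \<in> inside (pts {{a, b}, {a, u}, {u, b}})"
    then have "p d \<in> inside (pts {{a, b}, {a, u}, {u, b}})"
      using inside_same_component[OF edge_same_side, of w d "{{a, b}, {a, u}, {u, b}}"] E E' n by auto
    with split1 T show False by blast
  qed
  ultimately have wQ: "p w \<in> inside ?Q" using split1 by blast
  obtain q where q: "q \<in> pts {{d, u}}" "q \<noteq> p d" "q \<noteq> p u"
    \<comment> \<open>An inner point is needed to see that \<open>{d, u}\<close> runs through the
      inside of the quadrilateral, since both its ends lie on the boundary.\<close>
    using obtain_inner_point E by blast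
  have "q \<in> inside ?T"
    using inside_same_component[OF half_edge_same_side u, of d q] E E' n q by (auto simp: insert_commute)
  moreover have "pts {{d, u}} \<inter> pts {{a, u}, {u, b}} = {p u}"
    by (subst pts_Int) (use E E' n in \<open>auto simp: doubleton_eq_iff\<close>)
  then have "q \<notin> pts {{a, u}, {u, b}}" using q by blast
  moreover have "q \<notin> inside (pts {{a, b}, {a, u}, {u, b}})"
  proof
    assume *: "q \<in> inside (pts {{a, b}, {a, u}, {u, b}})"
    have "connected_component (- pts {{a, b}, {a, u}, {u, b}}) (p d) q"
      using half_edge_same_side[of d u "{{a, b}, {a, u}, {u, b}}" q] E E' n q by auto
    then have "p d \<in> inside (pts {{a, b}, {a, u}, {u, b}})"
      using * inside_same_component connected_component_sym by metis
    with split1 T show False by blast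
  qed
  ultimately have "q \<in> inside ?Q" using split1 by blast
  then have split2: "inside ?Q = inside (pts {{d, a}, {a, u}, {d, u}}) \<union>
      inside (pts {{d, b}, {b, u}, {d, u}}) \<union> (pts {{d, u}} - {p d, p u})"
    using split_quadrilateral[of d a u b] E E' n q by blast
  have "p w \<notin> pts {{d, u}}"
    using V E E' n pts_vertex[of "{{d, u}}" w] by auto
  with split2 wQ consider "p w \<in> inside (pts {{d, a}, {a, u}, {d, u}})"
    | "p w \<in> inside (pts {{d, b}, {b, u}, {d, u}})" by blast
  then show False
  proof cases
    case 1
    then have "p b \<in> inside (pts {{d, a}, {a, u}, {d, u}})"
      using inside_same_component[OF edge_same_side, of w b "{{d, a}, {a, u}, {d, u}}"] E E' n by auto
    with split1 split2 T show False by blast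
  next
    case 2
    then have "p a \<in> inside (pts {{d, b}, {b, u}, {d, u}})"
      using inside_same_component[OF edge_same_side, of w a "{{d, b}, {b, u}, {d, u}}"] E E' n by auto
    with split1 split2 T show False by blast
  qed
qed

end

section \<open>Inversion at a point inside a Jordan curve\<close>

lemma inside_inversion:
  fixes g :: "real \<Rightarrow> complex"
  assumes "simple_path g" "pathfinish g = pathstart g"
    and q: "q \<in> inside (path_image g)" and z: "z \<in> outside (path_image g)"
  shows "1 / (z - q) \<in> inside ((\<lambda>z. 1 / (z - q)) ` path_image g)"
proof -
  let ?T = "path_image g" and ?f = "\<lambda>z. 1 / (z - q)"
  \<comment> \<open>The inversion turns the ball around \<open>q\<close> into a neighbourhood of
    infinity, so a set that avoids the ball has a bounded image.\<close>
  have "open (inside ?T)" using assms Jordan_inside_outside by blast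
  then obtain \<delta> where \<delta>: "\<delta> > 0" "ball q \<delta> \<subseteq> inside ?T"
    using q open_contains_ball by blast
  have qT: "q \<notin> ?T" using q inside_no_overlap by blast
  have "compact ?T" using assms by (simp add: compact_simple_path_image)
  moreover have "continuous_on ?T ?f" using qT by (auto intro!: continuous_intros)
  ultimately have "closed (?f ` ?T)"
    by (simp add: compact_continuous_image compact_imp_closed)
  \<comment> \<open>The component to be shown bounded. Pulled back by the inverse map it is
    connected, avoids the curve and contains \<open>z\<close>, so it lies in the outside and avoids
    the ball.\<close>
  define C where "C = connected_component_set (- (?f ` ?T)) (?f z)"
  have zq: "z \<noteq> q" using q z inside_Int_outside by blast
  have "z \<notin> ?T" using z outside_no_overlap by blast
  have "?f z \<notin> ?f ` ?T"
  proof
    assume "?f z \<in> ?f ` ?T"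
    then obtain t where "t \<in> ?T" "?f z = ?f t" by blast
    with zq qT have "z = t" by (auto simp: field_simps)
    with \<open>t \<in> ?T\<close> \<open>z \<notin> ?T\<close> show False by simp
  qed
  then have fC: "?f z \<in> C" by (simp add: C_def)
  have "open C" unfolding C_def using \<open>closed (?f ` ?T)\<close> by (intro open_connected_component) auto
  \<comment> \<open>\<open>0\<close> corresponds to infinity and has no preimage; deleting one point
    keeps an open connected set of the plane connected.\<close>
  then have "connected (C - {0})"
    by (intro connected_open_delete) (simp_all add: C_def)
  then have con: "connected ((\<lambda>w. q + 1 / w) ` (C - {0}))"
    by (rule connected_continuous_image[rotated]) (auto intro!: continuous_intros)
  have sub: "(\<lambda>w. q + 1 / w) ` (C - {0}) \<subseteq> - ?T"
  proof clarsimp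
    fix w assume w: "w \<in> C" "w \<noteq> 0" "q + 1 / w \<in> ?T"
    then have "?f (q + 1 / w) \<in> ?f ` ?T" by blast
    with w have "w \<in> ?f ` ?T" by simp
    with w(1) connected_component_subset show False unfolding C_def by fastforce
  qed
  have "?f z \<noteq> 0" using zq by simp
  with fC have zin: "z \<in> (\<lambda>w. q + 1 / w) ` (C - {0})"
    by (intro image_eqI[of _ _ "?f z"]) auto
  have "C \<subseteq> cball 0 (1 / \<delta>)"
  proof
    fix w assume w: "w \<in> C"
    show "w \<in> cball 0 (1 / \<delta>)"
    proof (cases "w = 0")
      case True
      then show ?thesis using \<delta> by simp
    next
      case False
      then have "q + 1 / w \<in> (\<lambda>w. q + 1 / w) ` (C - {0})" using w by blast
      then have "connected_component (- ?T) z (q + 1 / w)"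
        using connected_componentI con sub zin by metis
      then have "q + 1 / w \<in> outside ?T" using z outside_same_component by metis
      then have "q + 1 / w \<notin> ball q \<delta>" using \<delta> inside_Int_outside by blast
      then have "norm (1 / w) \<ge> \<delta>" by (simp add: dist_norm)
      then show ?thesis using False \<delta> by (simp add: norm_divide field_simps)
    qed
  qed
  then have "bounded C" using bounded_subset bounded_cball by blast
  then show ?thesis
    using \<open>?f z \<notin> ?f ` ?T\<close> unfolding inside_def C_def by simp
qed

text \<open>A common point of two remaining arcs is a vertex point on both, hence an end of a
  remaining edge, and therefore the point of a vertex in \<open>V'\<close>.\<close>

lemma plane_drawing_restrict:
  assumes "plane_drawing V E p c" "V' \<subseteq> V" "E' \<subseteq> E" "simple_graph V E" "simple_graph V' E'"
  shows "plane_drawing V' E' p c"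
  unfolding plane_drawing_def
proof (intro conjI ballI impI)
  interpret plane_graph V E p c using assms by unfold_locales
  show "inj_on p V'" using inj_p assms(2) inj_on_subset by blast
  fix e assume e: "e \<in> E'"
  then show "arc (c e)" "{pathstart (c e), pathfinish (c e)} = p ` e"
    using assms(1) subsetD[OF assms(3) e] unfolding plane_drawing_def by metis+
  have eV: "e \<subseteq> V'" using e assms(5) by (auto simp: simple_graph_def)
  have "path_image (c e) \<inter> p ` V = p ` e" using e assms edge_vertices by blast
  then show "path_image (c e) \<inter> p ` V' = p ` e" using eV assms(2) by blast
  fix f assume f: "f \<in> E'" and "e \<noteq> f"
  then have "path_image (c e) \<inter> path_image (c f) \<subseteq> p ` V" using e assms edges_meet by blast
  moreover have "path_image (c f) \<inter> p ` V = p ` f" using f assms edge_vertices by blast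
  ultimately show "path_image (c e) \<inter> path_image (c f) \<subseteq> p ` V'"
    using \<open>path_image (c e) \<inter> p ` V = p ` e\<close> eV by blast
qed

lemma plane_drawing_image:
  assumes "plane_drawing V E p c" and V: "p ` V \<subseteq> S" and E: "\<And>e. e \<in> E \<Longrightarrow> path_image (c e) \<subseteq> S"
    and cont: "continuous_on S f" and inj: "inj_on f S"
  shows "plane_drawing V E (f \<circ> p) (\<lambda>e. f \<circ> c e)"
proof -
  have int: "f ` A \<inter> f ` B = f ` (A \<inter> B)" if "A \<subseteq> S" "B \<subseteq> S" for A B
    using inj_on_image_Int[OF inj that] by simp
  note D = assms(1)[unfolded plane_drawing_def]
  show ?thesis
    unfolding plane_drawing_def
  proof (intro conjI ballI impI)
    show "inj_on (f \<circ> p) V"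
      using D V inj by (auto intro!: comp_inj_on intro: inj_on_subset)
    fix e assume e: "e \<in> E"
    then have De: "arc (c e)" "{pathstart (c e), pathfinish (c e)} = p ` e"
      "path_image (c e) \<inter> p ` V = p ` e"
      using D by blast+
    show "arc (f \<circ> c e)"
      using De(1) E[OF e] cont inj
      by (auto simp: arc_def path_image_def intro!: path_continuous_image comp_inj_on
          intro: continuous_on_subset inj_on_subset)
    have "{pathstart (f \<circ> c e), pathfinish (f \<circ> c e)} = f ` {pathstart (c e), pathfinish (c e)}"
      by (simp add: pathstart_def pathfinish_def)
    then show "{pathstart (f \<circ> c e), pathfinish (f \<circ> c e)} = (f \<circ> p) ` e"
      unfolding De(2) by (simp add: image_comp)
    have "path_image (f \<circ> c e) \<inter> (f \<circ> p) ` V = f ` (path_image (c e) \<inter> p ` V)"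
      using int[OF E[OF e] V] by (simp add: path_image_compose image_comp)
    then show "path_image (f \<circ> c e) \<inter> (f \<circ> p) ` V = (f \<circ> p) ` e"
      unfolding De(3) by (simp add: image_comp)
    fix e' assume e': "e' \<in> E" and "e \<noteq> e'"
    have "path_image (f \<circ> c e) \<inter> path_image (f \<circ> c e') = f ` (path_image (c e) \<inter> path_image (c e'))"
      using int[OF E[OF e] E[OF e']] by (simp add: path_image_compose)
    moreover have "path_image (c e) \<inter> path_image (c e') \<subseteq> p ` V"
      using D e e' \<open>e \<noteq> e'\<close> by blast
    ultimately show "path_image (f \<circ> c e) \<inter> path_image (f \<circ> c e') \<subseteq> (f \<circ> p) ` V"
      by (metis image_comp image_mono)
  qed
qed

context plane_graph
begin

text \<open>If \<open>u\<close> lies outside the triangle, inversion at a point \<open>q\<close>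
  inside moves it to the inside. The drawing has to avoid \<open>q\<close>, which is why all but
  five vertices are discarded first: the rest of the graph may well enter the triangle.\<close>

lemma no_K5:
  assumes dist: "distinct [a, b, d, u, w]"
    and K: "\<And>x y. \<lbrakk>x \<in> {a, b, d, u, w}; y \<in> {a, b, d, u, w}; x \<noteq> y\<rbrakk> \<Longrightarrow> {x, y} \<in> E"
  shows False
proof -
  define V' where "V' = {a, b, d, u, w}"
  define E' where "E' = {{x, y} | x y. x \<in> V' \<and> y \<in> V' \<and> x \<noteq> y}"
  have sE: "E' \<subseteq> E" using K by (auto simp: E'_def V'_def)
  have sV: "V' \<subseteq> V"
    using K[of a b] K[of d u] K[of w a] dist edge_ends[of a b] edge_ends[of d u] edge_ends[of w a]
    by (auto simp: V'_def)
  have sim: "simple_graph V' E'" by (auto simp: simple_graph_def E'_def)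
  have mem: "{x, y} \<in> E'" if "x \<in> V'" "y \<in> V'" "x \<noteq> y" for x y
    using that by (auto simp: E'_def)
  interpret K: plane_graph V' E' p c
    using sim plane_drawing_restrict[OF drawing sV sE simple] by unfold_locales
  have E: "{a, b} \<in> E'" "{a, d} \<in> E'" "{a, u} \<in> E'" "{a, w} \<in> E'" "{b, d} \<in> E'"
      "{b, u} \<in> E'" "{b, w} \<in> E'" "{d, u} \<in> E'" "{d, w} \<in> E'" "{u, w} \<in> E'" "{d, b} \<in> E'"
    using dist by (auto intro!: mem simp: V'_def)
  have V: "a \<in> V'" "b \<in> V'" "d \<in> V'" "u \<in> V'" "w \<in> V'" by (auto simp: V'_def)
  let ?F = "{{a, b}, {d, b}, {a, d}}"
  let ?T = "pts ?F"
  have FE: "?F \<subseteq> E'" using E by blast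
  have F: "pts ?F = K.pts ?F" by (simp add: pts_def K.pts_def)
  have "p u \<notin> ?T" using K.pts_vertex[OF FE V(4)] F dist by auto
  then consider "p u \<in> inside ?T" | "p u \<in> outside ?T"
    using inside_Un_outside by blast
  then show False
  proof cases
    case 1
    then show False using K.no_K5_inside[OF V E(1-10)] F by auto
  next
    case out: 2
    obtain g where g: "simple_path g" "pathfinish g = pathstart g" "path_image g = ?T"
      using K.obtain_triangle_loop[of a b d] E F by (auto simp: insert_commute)
    have "inside ?T \<noteq> {}" using Jordan_inside_outside[OF g(1,2)] g(3) by simp
    then obtain q where q: "q \<in> inside ?T" by blast
    have vertex: "p x \<notin> inside ?T" if "x \<in> V'" for x
    proof (cases "x \<in> {a, b, d}")
      case True
      then have "p x \<in> ?T" using K.pts_vertex[OF FE that] F by auto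
      then show ?thesis using inside_no_overlap by blast
    next
      case False
      then have "x = u \<or> x = w" using that by (auto simp: V'_def)
      moreover have "connected_component (- ?T) (p u) (p w)"
        using K.edge_same_side[OF E(10) FE] dist F by auto
      ultimately have "p x \<in> outside ?T" using out outside_same_component by metis
      then show ?thesis using inside_Int_outside by blast
    qed
    \<comment> \<open>An edge off the triangle has an end in \<open>{u, w}\<close>, which lies
      outside, and from there it stays outside up to its other end.\<close>
    have edge: "path_image (c e) \<inter> inside ?T = {}" if e: "e \<in> E'" for e
    proof (cases "e \<in> ?F")
      case True
      then have "path_image (c e) \<subseteq> ?T" by (auto simp: pts_def)
      then show ?thesis using inside_no_overlap by blast
    next
      case False
      from e obtain x y where xy: "e = {x, y}" "x \<in> V'" "y \<in> V'" "x \<noteq> y"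
        unfolding E'_def by blast
      obtain x y where xy: "e = {x, y}" "x \<in> V'" "y \<in> V'" "x \<noteq> y" "x \<notin> {a, b, d}"
      proof (cases "x \<in> {a, b, d}")
        case True
        with False xy have "y \<notin> {a, b, d}" by (auto simp: insert_commute)
        then show ?thesis using that[of y x] xy by (auto simp: insert_commute)
      qed (use xy that in auto)
      have "r \<notin> inside ?T" if "r \<in> path_image (c e)" for r
      proof (cases "r = p y")
        case True
        then show ?thesis using vertex xy by simp
      next
        case False
        have "connected_component (- ?T) (p x) r"
          using K.half_edge_same_side[of x y ?F r] FE F xy that \<open>e \<in> E'\<close> False by (auto simp: K.pts_def)
        moreover have "p x \<in> outside ?T"
        proof -
          have "p x \<notin> ?T" using K.pts_vertex[OF FE xy(2)] F xy(5) by auto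
          then show ?thesis using vertex[OF xy(2)] inside_Un_outside[of ?T] by blast
        qed
        ultimately have "r \<in> outside ?T" using outside_same_component by metis
        then show ?thesis using inside_Int_outside by blast
      qed
      then show ?thesis by blast
    qed
    let ?f = "\<lambda>z. 1 / (z - q)"
    have "plane_drawing V' E' (?f \<circ> p) (\<lambda>e. ?f \<circ> c e)"
    proof (rule plane_drawing_image[where S = "- {q}"])
      show "plane_drawing V' E' p c" by (rule K.drawing)
      show "p ` V' \<subseteq> - {q}" using vertex q by auto
      show "path_image (c e) \<subseteq> - {q}" if "e \<in> E'" for e using edge[OF that] q by auto
      show "continuous_on (- {q}) ?f" by (auto intro!: continuous_intros)
      show "inj_on ?f (- {q})" by (auto intro!: inj_onI simp: field_simps)
    qed
    then interpret I: plane_graph V' E' "?f \<circ> p" "\<lambda>e. ?f \<circ> c e"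
      using sim by unfold_locales
    have "I.pts ?F = ?f ` ?T" by (auto simp: I.pts_def pts_def path_image_compose)
    moreover have "?f (p u) \<in> inside (?f ` ?T)"
      using inside_inversion[OF g(1,2)] g(3) q out by simp
    ultimately show False using I.no_K5_inside[OF V E(1-10)] by simp
  qed
qed

text \<open>The side of a triangle that does not contain the vertex \<open>v\<close> contains no other vertices or
  edges, since everything is joined to \<open>v\<close>. So these sides are disjoint nonempty open sets.\<close>

lemma countable_triangles:
  assumes v: "v \<in> V" "\<And>x. \<lbrakk>x \<in> V; x \<noteq> v\<rbrakk> \<Longrightarrow> {v, x} \<in> E"
  shows "countable {{x, y, z} | x y z. {x, y} \<in> E \<and> {y, z} \<in> E \<and> {x, z} \<in> E \<and> v \<notin> {x, y, z}}"
    (is "countable ?\<T>")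
proof -
  define F where "F t = {{x, y} | x y. x \<in> t \<and> y \<in> t \<and> x \<noteq> y}" for t :: "'a set"
  define far where "far t = (if p v \<in> inside (pts (F t)) then outside (pts (F t)) else inside (pts (F t)))" for t
  have tri: "F t \<subseteq> E" "\<Union>(F t) = t" "v \<notin> t" "t \<subseteq> V"
    "\<exists>g. simple_path g \<and> pathfinish g = pathstart g \<and> path_image g = pts (F t)" if "t \<in> ?\<T>" for t
  proof -
    from that
    obtain x y z where t: "t = {x, y, z}" "{x, y} \<in> E" "{y, z} \<in> E" "{x, z} \<in> E" "v \<notin> {x, y, z}"
      by blast
    have n: "x \<noteq> y" "y \<noteq> z" "x \<noteq> z" using t edge_neq by auto
    have F: "F t = {{x, y}, {y, z}, {x, z}}"
      unfolding F_def t(1) using n by (auto simp: insert_commute)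
    show "F t \<subseteq> E" "\<Union>(F t) = t" "v \<notin> t" "t \<subseteq> V" using F t edge_ends by auto
    show "\<exists>g. simple_path g \<and> pathfinish g = pathstart g \<and> path_image g = pts (F t)"
      using obtain_triangle_loop t F by metis
  qed
  have far: "open (far t)" "connected (far t)" "far t \<noteq> {}" "far t \<subseteq> - pts (F t)"
    "frontier (far t) = pts (F t)" if t: "t \<in> ?\<T>" for t
  proof -
    obtain g where g: "simple_path g" "pathfinish g = pathstart g" "path_image g = pts (F t)"
      using tri(5)[OF t] by blast
    then have J: "inside (pts (F t)) \<noteq> {}" "open (inside (pts (F t)))" "connected (inside (pts (F t)))"
      "frontier (inside (pts (F t))) = pts (F t)" "outside (pts (F t)) \<noteq> {}"
      "open (outside (pts (F t)))" "connected (outside (pts (F t)))"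
      "frontier (outside (pts (F t))) = pts (F t)"
      using Jordan_inside_outside[of g] by simp_all
    show "open (far t)" "connected (far t)" "far t \<noteq> {}" "far t \<subseteq> - pts (F t)"
      "frontier (far t) = pts (F t)"
      using J inside_no_overlap[of "pts (F t)"] outside_no_overlap[of "pts (F t)"]
      unfolding far_def by (auto simp del: inside_no_overlap outside_no_overlap)
  qed
  have far_closed: "r \<in> far t" if "q \<in> far t" "connected_component (- pts (F t)) q r" for t q r
    using that inside_same_component outside_same_component unfolding far_def by metis
  have v_far: "p v \<notin> far t" for t
    using inside_Int_outside[of "pts (F t)"] unfolding far_def by (metis IntI empty_iff)
  have near: "q \<notin> far t" if "connected_component (- pts (F t)) (p v) q" for t q
    using that far_closed v_far connected_component_sym by metis
  \<comment> \<open>The whole triangle \<open>t\<close> avoids \<open>far s\<close>: a vertex of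
    \<open>t\<close> not in \<open>s\<close> is joined to \<open>v\<close> off \<open>s\<close>, and
    a side of \<open>t\<close> is a side of \<open>s\<close> or starts at such a vertex. So
    \<open>far s\<close> is connected, misses the curve of \<open>t\<close> and stays on one side of
    it.\<close>
  have far_sub: "far s \<subseteq> far t" if s: "s \<in> ?\<T>" and t: "t \<in> ?\<T>" and ne: "far s \<inter> far t \<noteq> {}" for s t
  proof -
    have near_vertex: "connected_component (- pts (F s)) (p v) (p x)" if "x \<in> t" "x \<notin> s" for x
    proof (rule edge_same_side)
      have "x \<in> V" "x \<noteq> v" using that(1) tri(3,4)[OF t] by auto
      then show "{v, x} \<in> E" by (rule v(2))
    qed (use tri(1-3)[OF s] that in auto)
    have "r \<notin> far s" if "r \<in> pts (F t)" for r
    proof -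
      from that obtain e where e: "e \<in> F t" "r \<in> pts {e}" by (auto simp: pts_def)
      obtain x y where "e = {x, y}" using e(1) unfolding F_def by blast
      with e have xy: "{x, y} \<in> F t" "r \<in> pts {{x, y}}" by simp_all
      have xyE: "{x, y} \<in> E" using xy(1) tri(1)[OF t] by blast
      have xyt: "x \<in> t" "y \<in> t" "x \<noteq> y" using xy(1) tri(2)[OF t] edge_neq[OF xyE] by auto
      have half: "r' \<notin> far s" if "{a, b} \<in> E" "a \<in> t" "a \<notin> s" "b \<in> t" "r' \<in> pts {{a, b}}" for a b r'
      proof (cases "r' = p b")
        case True
        show ?thesis
        proof (cases "b \<in> s")
          case True
          then have "p b \<in> pts (F s)"
            using pts_vertex[OF tri(1)[OF s]] tri(2)[OF s] edge_ends[OF that(1)] by simp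
          then show ?thesis using far(4)[OF s] \<open>r' = p b\<close> by blast
        next
          case False
          then show ?thesis using near near_vertex that \<open>r' = p b\<close> by blast
        qed
      next
        case False
        have "connected_component (- pts (F s)) (p a) r'"
          using half_edge_same_side[OF that(1) tri(1)[OF s]] tri(2)[OF s] that False by blast
        then show ?thesis
          using near near_vertex[OF that(2,3)] connected_component_trans by metis
      qed
      show ?thesis
      proof (cases "x \<in> s \<and> y \<in> s")
        case True
        then have "{x, y} \<in> F s" using xyt(3) by (auto simp: F_def)
        then have "r \<in> pts (F s)" using xy(2) by (auto simp: pts_def)
        then show ?thesis using far(4)[OF s] by blast
      next
        case False
        then show ?thesis
          using half[of x y r] half[of y x r] xyE xyt xy(2) by (auto simp: insert_commute)
      qed
    qed
    then have "far s \<subseteq> - pts (F t)" by blast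
    moreover obtain q where "q \<in> far s" "q \<in> far t" using ne by blast
    ultimately show ?thesis
      using far_closed far(2)[OF s] connected_componentI by (metis subsetI)
  qed
  \<comment> \<open>Overlapping far sides are equal, so they have equal frontiers, and these
    determine the vertices of the triangle.\<close>
  have inj: "s = t" if s: "s \<in> ?\<T>" and t: "t \<in> ?\<T>" and ne: "far s \<inter> far t \<noteq> {}" for s t
  proof -
    have "far s = far t" using far_sub[OF s t] far_sub[OF t s] ne by (auto simp: Int_commute)
    then have eq: "pts (F s) = pts (F t)" using far(5)[OF s] far(5)[OF t] by simp
    have "x \<in> s \<longleftrightarrow> x \<in> t" if "x \<in> V" for x
      using pts_vertex[OF tri(1)[OF s] that] pts_vertex[OF tri(1)[OF t] that] tri(2)[OF s] tri(2)[OF t] eq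
      by simp
    then show ?thesis using tri(4)[OF s] tri(4)[OF t] by blast
  qed
  have "countable (far ` ?\<T>)"
  proof (rule countable_disjoint_open_subsets)
    show "open S" if "S \<in> far ` ?\<T>" for S using that far(1) by blast
    show "pairwise disjnt (far ` ?\<T>)"
    proof (rule pairwiseI)
      fix S S' assume "S \<in> far ` ?\<T>" "S' \<in> far ` ?\<T>" "S \<noteq> S'"
      then obtain s s' where "S = far s" "S' = far s'" "s \<in> ?\<T>" "s' \<in> ?\<T>" by blast
      then show "disjnt S S'"
        using inj[of s s'] \<open>S \<noteq> S'\<close> unfolding disjnt_def by metis
    qed
  qed
  moreover have "inj_on far ?\<T>"
  proof (rule inj_onI)
    fix s t assume "s \<in> ?\<T>" "t \<in> ?\<T>" "far s = far t"
    then show "s = t" using inj[of s t] far(3)[of s] by simp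
  qed
  ultimately show ?thesis using countable_image_inj_on by blast
qed

end

subsection \<open>Drawings with all but one vertex on a line\<close>

definition semicircle :: "real \<Rightarrow> real \<Rightarrow> real \<Rightarrow> complex" where
  "semicircle a b = part_circlepath (of_real ((a + b) / 2)) ((b - a) / 2) 0 pi"

lemma semicircle_ends:
  "pathstart (semicircle a b) = of_real b" "pathfinish (semicircle a b) = of_real a"
  by (simp_all add: semicircle_def field_simps complex_eq_iff)

lemma arc_semicircle: "a < b \<Longrightarrow> arc (semicircle a b)"
  unfolding semicircle_def by (intro arc_part_circlepath) auto

text \<open>The last equation is the altitude theorem for the diameter from \<open>a\<close> to
  \<open>b\<close>; over a fixed real part it reduces comparing heights to comparing
  products.\<close>

lemma semicircle_image:
  assumes "a < b" "z \<in> path_image (semicircle a b)"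
  shows "Im z \<ge> 0" "a \<le> Re z" "Re z \<le> b" "(Re z - a) * (b - Re z) = (Im z)\<^sup>2"
proof -
  obtain t where t: "0 \<le> t" "t \<le> pi"
    and z: "z = of_real ((a + b) / 2) + of_real ((b - a) / 2) * exp (\<i> * of_real t)"
    using assms(2) unfolding semicircle_def by (auto simp: path_image_part_circlepath)
  have Re: "Re z = (a + b) / 2 + (b - a) / 2 * cos t" and Im: "Im z = (b - a) / 2 * sin t"
    unfolding z by (simp_all add: cis_conv_exp[symmetric])
  show "Im z \<ge> 0" unfolding Im using sin_ge_zero[OF t] assms(1) by simp
  have "(b - a) * (1 + cos t) \<ge> 0" "(b - a) * (1 - cos t) \<ge> 0"
    using assms(1) cos_ge_minus_one[of t] cos_le_one[of t]
    by (intro mult_nonneg_nonneg; linarith)+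
  then show "a \<le> Re z" "Re z \<le> b" unfolding Re by (simp_all add: field_simps)
  have "(Re z - a) * (b - Re z) = ((b - a) / 2)\<^sup>2 * (1 - (cos t)\<^sup>2)"
    unfolding Re by (simp add: field_simps power2_eq_square)
  then show "(Re z - a) * (b - Re z) = (Im z)\<^sup>2"
    unfolding Im sin_squared_eq[symmetric] by (simp add: power_divide power_mult_distrib)
qed

lemma real_in_semicircle:
  assumes "a < b" "of_real x \<in> path_image (semicircle a b)"
  shows "x = a \<or> x = b"
  using semicircle_image(4)[OF assms] by auto

text \<open>Widening the interval strictly increases the product in \<open>semicircle_image\<close>
  over each point strictly between \<open>c\<close> and \<open>d\<close>, so there the outer
  semicircle is strictly higher.\<close>

lemma semicircles_nested:
  assumes "a \<le> c" "c < d" "d \<le> b" "a < c \<or> d < b"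
    and "z \<in> path_image (semicircle a b)" "z \<in> path_image (semicircle c d)"
  shows "z = of_real c \<or> z = of_real d"
proof -
  note 1 = semicircle_image[of a b z] and 2 = semicircle_image[of c d z]
  have eq: "(Re z - a) * (b - Re z) = (Re z - c) * (d - Re z)" using 1(4) 2(4) assms by simp
  have cd: "c \<le> Re z" "Re z \<le> d" using 2 assms by auto
  have "\<not> (c < Re z \<and> Re z < d)"
  proof
    assume *: "c < Re z \<and> Re z < d"
    have "(Re z - c) * (d - Re z) < (Re z - a) * (b - Re z)"
    proof (cases "a < c")
      case True
      with * assms show ?thesis by (intro mult_less_le_imp_less) auto
    next
      case False
      with * assms show ?thesis by (intro mult_le_less_imp_less) auto
    qed
    with eq show False by simp
  qed
  then have "Re z = c \<or> Re z = d" using cd by auto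
  moreover from this have "Im z = 0" using 2(4) assms by auto
  ultimately show ?thesis by (auto simp: complex_eq_iff)
qed

lemma semicircles_separate:
  assumes "a < b" "b \<le> c" "c < d"
    and "z \<in> path_image (semicircle a b)" "z \<in> path_image (semicircle c d)"
  shows "z = of_real b"
proof -
  have "Re z = b"
    using semicircle_image[of a b z] semicircle_image[of c d z] assms by auto
  with semicircle_image(4)[of a b z] assms show ?thesis by (auto simp: complex_eq_iff)
qed

lemma semicircles_noncrossing:
  assumes "a < b" "c < d" "(a, b) \<noteq> (c, d)"
    and "\<not> (a < c \<and> c < b \<and> b < d)" "\<not> (c < a \<and> a < d \<and> d < b)"
    and "z \<in> path_image (semicircle a b)" "z \<in> path_image (semicircle c d)"
  shows "z \<in> of_real ` ({a, b} \<union> {c, d})"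
proof -
  consider "b \<le> c" | "d \<le> a" | "a \<le> c" "d \<le> b" | "c \<le> a" "b \<le> d"
    using assms by linarith
  then show ?thesis
    using semicircles_separate[of a b c d z] semicircles_separate[of c d a b z]
      semicircles_nested[of a c d b z] semicircles_nested[of c a b d z] assms
    by cases auto
qed

text \<open>\<open>1 + Im z\<close> is the scaling factor at the height of \<open>z\<close>, so
  segments to distinct real points meet only where it vanishes, at the apex.\<close>

lemma closed_segment_minus_i:
  assumes "z \<in> closed_segment (- \<i>) (of_real x)"
  shows "Im z \<le> 0" "Re z = x * (1 + Im z)" "-1 \<le> Im z"
proof -
  obtain t where "0 \<le> t" "t \<le> 1" "z = (1 - t) *\<^sub>R (- \<i>) + t *\<^sub>R of_real x"
    using assms by (auto simp: closed_segment_def)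
  then show "Im z \<le> 0" "Re z = x * (1 + Im z)" "-1 \<le> Im z" by simp_all
qed

text \<open>Quantifying over all ways to write the edges covers both orientations and both orders of
  two edges with a single pattern of inequalities.\<close>

definition noncrossing :: "('a \<Rightarrow> real) \<Rightarrow> 'a set set \<Rightarrow> bool" where
  "noncrossing \<sigma> E \<longleftrightarrow>
     (\<forall>a b c d. {a, b} \<in> E \<longrightarrow> {c, d} \<in> E \<longrightarrow> \<not> (\<sigma> a < \<sigma> c \<and> \<sigma> c < \<sigma> b \<and> \<sigma> b < \<sigma> d))"

text \<open>The vertex \<open>v\<close> is placed at \<open>-\<i>\<close> and the others on the real line. Edges at \<open>v\<close> are drawn as
  segments in the lower half-plane, the remaining ones as semicircles in the upper half-plane.\<close>

lemma planar_apex_noncrossing: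
  assumes simple: "simple_graph V E" and inj: "inj_on \<sigma> (V - {v})"
    and nc: "noncrossing \<sigma> {e \<in> E. v \<notin> e}"
  shows "planar V E"
proof -
  define p where "p x = (if x = v then - \<i> else of_real (\<sigma> x))" for x
  define c where "c e = (if v \<in> e then linepath (- \<i>) (of_real (\<sigma> (the_elem (e - {v}))))
    else semicircle (Min (\<sigma> ` e)) (Max (\<sigma> ` e)))" for e
  have E: "e \<subseteq> V" "card e = 2" if "e \<in> E" for e using simple that by (auto simp: simple_graph_def)
  have spoke: "\<exists>x. e = {v, x} \<and> x \<noteq> v \<and> x \<in> V \<and> c e = linepath (- \<i>) (of_real (\<sigma> x))"
    if e: "e \<in> E" "v \<in> e" for e
  proof -
    obtain x where x: "e = {v, x}" "x \<noteq> v"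
      using E(2)[OF e(1)] e(2) by (auto simp: card_2_iff doubleton_eq_iff)
    then have "e - {v} = {x}" by blast
    then show ?thesis using x E(1)[OF e(1)] by (auto simp: c_def)
  qed
  have chord: "\<exists>x y. e = {x, y} \<and> x \<in> V - {v} \<and> y \<in> V - {v} \<and> \<sigma> x < \<sigma> y \<and> c e = semicircle (\<sigma> x) (\<sigma> y)"
    if e: "e \<in> E" "v \<notin> e" for e
  proof -
    obtain x y where xy: "e = {x, y}" "x \<noteq> y" using E(2)[OF e(1)] by (auto simp: card_2_iff)
    have V: "x \<in> V - {v}" "y \<in> V - {v}" using xy E(1)[OF e(1)] e(2) by auto
    then have "\<sigma> x \<noteq> \<sigma> y" using inj xy(2) inj_on_eq_iff by metis
    then consider "\<sigma> x < \<sigma> y" | "\<sigma> y < \<sigma> x" by linarith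
    then show ?thesis
    proof cases
      case 1
      then have "c e = semicircle (\<sigma> x) (\<sigma> y)" using e(2) xy(1) by (simp add: c_def)
      with 1 V xy show ?thesis by blast
    next
      case 2
      then have "c e = semicircle (\<sigma> y) (\<sigma> x)" using e(2) xy(1) by (simp add: c_def)
      with 2 V xy show ?thesis by (metis insert_commute)
    qed
  qed
  have pv: "p v = - \<i>" and px: "p x = of_real (\<sigma> x)" if "x \<noteq> v" for x using that by (auto simp: p_def)
  have arcs: "arc (c e) \<and> {pathstart (c e), pathfinish (c e)} = p ` e" if e: "e \<in> E" for e
  proof (cases "v \<in> e")
    case True
    then obtain x where x: "e = {v, x}" "x \<noteq> v" "c e = linepath (- \<i>) (of_real (\<sigma> x))"
      using spoke e by blast
    have "- \<i> \<noteq> of_real (\<sigma> x)" by (simp add: complex_eq_iff)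
    then show ?thesis using x px by (auto simp: p_def)
  next
    case False
    then obtain x y where "e = {x, y}" "x \<in> V - {v}" "y \<in> V - {v}" "\<sigma> x < \<sigma> y" "c e = semicircle (\<sigma> x) (\<sigma> y)"
      using chord e by blast
    then show ?thesis by (auto simp: arc_semicircle semicircle_ends px)
  qed
  have ends: "p ` e \<subseteq> path_image (c e)" if "e \<in> E" for e
    using arcs[OF that] pathstart_in_path_image pathfinish_in_path_image by (metis empty_subsetI insert_subset)
  have vertex: "u \<in> e" if e: "e \<in> E" and u: "u \<in> V" "p u \<in> path_image (c e)" for e u
  proof (cases "v \<in> e")
    case True
    then obtain x where x: "e = {v, x}" "x \<noteq> v" "x \<in> V" "c e = linepath (- \<i>) (of_real (\<sigma> x))"
      using spoke e by blast
    show ?thesis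
    proof (cases "u = v")
      case False
      then have "\<sigma> u = \<sigma> x"
        using u closed_segment_minus_i(2)[of "p u" "\<sigma> x"] x(4) px[OF False] by auto
      then have "u = x" using inj x u False inj_on_eq_iff[OF inj, of u x] by blast
      then show ?thesis using x by simp
    qed (use True in simp)
  next
    case False
    then obtain x y where xy: "e = {x, y}" "x \<in> V - {v}" "y \<in> V - {v}" "\<sigma> x < \<sigma> y" "c e = semicircle (\<sigma> x) (\<sigma> y)"
      using chord e by blast
    have "u \<noteq> v"
      using u semicircle_image(1)[of "\<sigma> x" "\<sigma> y" "p u"] xy by (auto simp: p_def)
    then have "\<sigma> u = \<sigma> x \<or> \<sigma> u = \<sigma> y"
      using real_in_semicircle[of "\<sigma> x" "\<sigma> y" "\<sigma> u"] u xy by (simp add: px)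
    then have "u = x \<or> u = y"
      using inj xy u \<open>u \<noteq> v\<close> inj_on_eq_iff[OF inj, of u x] inj_on_eq_iff[OF inj, of u y] by blast
    then show ?thesis using xy by simp
  qed
  have spoke_chord: "z \<in> p ` V"
    if e: "e \<in> E" "v \<in> e" and f: "f \<in> E" "v \<notin> f" and z: "z \<in> path_image (c e)" "z \<in> path_image (c f)"
    for e f z
  proof -
    obtain x where x: "e = {v, x}" "x \<noteq> v" "x \<in> V" "c e = linepath (- \<i>) (of_real (\<sigma> x))"
      using spoke e by blast
    obtain y w where yw: "f = {y, w}" "y \<in> V - {v}" "w \<in> V - {v}" "\<sigma> y < \<sigma> w" "c f = semicircle (\<sigma> y) (\<sigma> w)"
      using chord f by blast
    have "Im z = 0"
      using closed_segment_minus_i(1)[of z "\<sigma> x"] semicircle_image(1)[of "\<sigma> y" "\<sigma> w" z] x yw z by auto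
    then have "z = p x"
      using closed_segment_minus_i(2)[of z "\<sigma> x"] x z by (auto simp: px complex_eq_iff)
    then show ?thesis using x by simp
  qed
  have meet: "z \<in> p ` V"
    if e: "e \<in> E" and f: "f \<in> E" and ef: "e \<noteq> f" and z: "z \<in> path_image (c e)" "z \<in> path_image (c f)"
    for e f z
  proof -
    consider "v \<in> e" "v \<in> f" | "v \<in> e" "v \<notin> f" | "v \<notin> e" "v \<in> f" | "v \<notin> e" "v \<notin> f" by blast
    then show ?thesis
    proof cases
      case 1
      obtain x where x: "e = {v, x}" "x \<noteq> v" "x \<in> V" "c e = linepath (- \<i>) (of_real (\<sigma> x))"
        using spoke e 1 by blast
      obtain y where y: "f = {v, y}" "y \<noteq> v" "y \<in> V" "c f = linepath (- \<i>) (of_real (\<sigma> y))"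
        using spoke f 1 by blast
      have "\<sigma> x \<noteq> \<sigma> y" using inj_on_eq_iff[OF inj, of x y] x y ef by blast
      moreover have "\<sigma> x * (1 + Im z) = \<sigma> y * (1 + Im z)" "Re z = \<sigma> x * (1 + Im z)"
        using closed_segment_minus_i(2)[of z "\<sigma> x"] closed_segment_minus_i(2)[of z "\<sigma> y"]
          z[unfolded x(4) y(4) path_image_linepath] by auto
      ultimately have "z = - \<i>" by (auto simp: complex_eq_iff)
      moreover have "v \<in> V" using E(1)[OF e] x by blast
      ultimately show ?thesis using pv[OF x(2)] by (metis image_eqI)
    next
      case 4
      obtain a b where ab: "e = {a, b}" "a \<in> V - {v}" "b \<in> V - {v}" "\<sigma> a < \<sigma> b" "c e = semicircle (\<sigma> a) (\<sigma> b)"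
        using chord e 4 by blast
      obtain y w where yw: "f = {y, w}" "y \<in> V - {v}" "w \<in> V - {v}" "\<sigma> y < \<sigma> w" "c f = semicircle (\<sigma> y) (\<sigma> w)"
        using chord f 4 by blast
      have "\<not> (\<sigma> a < \<sigma> y \<and> \<sigma> y < \<sigma> b \<and> \<sigma> b < \<sigma> w)" "\<not> (\<sigma> y < \<sigma> a \<and> \<sigma> a < \<sigma> w \<and> \<sigma> w < \<sigma> b)"
        using nc e f 4 ab(1) yw(1) unfolding noncrossing_def by blast+
      moreover have "(\<sigma> a, \<sigma> b) \<noteq> (\<sigma> y, \<sigma> w)"
        using inj_on_eq_iff[OF inj, of a y] inj_on_eq_iff[OF inj, of b w] ab yw ef by blast
      ultimately have "z \<in> of_real ` ({\<sigma> a, \<sigma> b} \<union> {\<sigma> y, \<sigma> w})"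
        using semicircles_noncrossing ab yw z by metis
      then show ?thesis using ab yw px by (force simp: image_iff)
    qed (use spoke_chord e f z in blast)+
  qed
  have "inj_on p V"
  proof (rule inj_onI)
    fix x y assume xy: "x \<in> V" "y \<in> V" "p x = p y"
    then show "x = y"
      using inj_on_eq_iff[OF inj, of x y] by (auto simp: p_def complex_eq_iff split: if_splits)
  qed
  moreover have "path_image (c e) \<inter> p ` V = p ` e" if "e \<in> E" for e
    using vertex[OF that] ends[OF that] E(1)[OF that] by blast
  ultimately have "plane_drawing V E p c"
    unfolding plane_drawing_def using arcs meet by blast
  then show ?thesis using simple by (auto simp: planar_def)
qed

text \<open>Apart from the apex at most three vertices remain, while a crossing takes four distinct
  ones on the line.\<close>

lemma planar_card_le_4:
  assumes "simple_graph V E" "finite V" "card V \<le> 4"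
  shows "planar V E"
proof -
  obtain v where v: "v \<in> V \<or> V = {}" by blast
  obtain \<sigma> :: "'a \<Rightarrow> nat" where "inj_on \<sigma> (V - {v})"
    using assms finite_imp_inj_to_nat_seg by (metis finite_Diff)
  then have inj: "inj_on (\<lambda>x. real (\<sigma> x)) (V - {v})" by (auto simp: inj_on_def)
  have "noncrossing (\<lambda>x. real (\<sigma> x)) {e \<in> E. v \<notin> e}"
    unfolding noncrossing_def
  proof (intro allI impI notI)
    fix a b c d assume "{a, b} \<in> {e \<in> E. v \<notin> e}" "{c, d} \<in> {e \<in> E. v \<notin> e}"
      and s: "real (\<sigma> a) < real (\<sigma> c) \<and> real (\<sigma> c) < real (\<sigma> b) \<and> real (\<sigma> b) < real (\<sigma> d)"
    then have "{a, b, c, d} \<subseteq> V - {v}" using assms(1) by (auto simp: simple_graph_def)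
    then have "card {a, b, c, d} \<le> card (V - {v})" using assms by (intro card_mono) auto
    moreover have "distinct [a, b, c, d]" using s by auto
    then have "card {a, b, c, d} = 4" by (simp add: card_insert_if)
    ultimately show False using assms v by auto
  qed
  then show ?thesis using planar_apex_noncrossing[OF assms(1) inj] by blast
qed

subsection \<open>Power graphs of groups with small element orders\<close>

lemma doubleton_power_graph_edges_iff:
  "{x, y} \<in> power_graph_edges G \<longleftrightarrow>
     x \<in> carrier G \<and> y \<in> carrier G \<and> x \<noteq> y \<and> (x \<in> generate G {y} \<or> y \<in> generate G {x})"
  unfolding power_graph_edges_def by (auto simp: doubleton_eq_iff)

context group
begin

text \<open>Infinite order is \<open>ord x = 0\<close>, and divisibility by 0 means being 0, so the
  congruence criterion covers infinite cyclic groups as well.\<close>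

lemma int_pow_mem_generate:
  assumes "x \<in> carrier G" "int (ord x) dvd j * k - i"
  shows "x [^] (i::int) \<in> generate G {x [^] (j::int)}"
proof -
  have "x [^] i = (x [^] j) [^] k"
    using assms by (simp add: int_pow_pow int_pow_eq)
  then show ?thesis using assms(1) by (auto simp: generate_pow)
qed

lemma one_edge:
  assumes "x \<in> carrier G" "x \<noteq> \<one>"
  shows "{\<one>, x} \<in> power_graph_edges G"
  using assms by (auto simp: doubleton_power_graph_edges_iff generate.one)

text \<open>The exponents 1, -1, \<open>u\<close>, \<open>-u\<close> are units modulo the order, so
  they give generators, which are adjacent to everything in the cyclic group; the identity is the
  fifth vertex. The three conditions keep the four generators distinct.\<close>

lemma five_units_K5:
  assumes x: "x \<in> carrier G" and u: "coprime u (int (ord x))"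
    and nd: "\<not> int (ord x) dvd u - 1" "\<not> int (ord x) dvd u + 1" "\<not> int (ord x) dvd 2"
  shows "\<exists>a b c d e. distinct [a, b, c, d, e] \<and>
    (\<forall>y\<in>{a, b, c, d, e}. \<forall>z\<in>{a, b, c, d, e}. y \<noteq> z \<longrightarrow> {y, z} \<in> power_graph_edges G)"
proof -
  define n where "n = int (ord x)"
  \<comment> \<open>Bezout: \<open>k\<close> inverts \<open>u\<close> modulo
    \<open>n\<close>.\<close>
  obtain k l where "k * u + l * n = 1" using bezout_int[of u n] u by (auto simp: n_def)
  then have "u * k - 1 = n * (- l)" by (simp add: algebra_simps)
  then have k: "n dvd u * k - 1" by (metis dvd_triv_left)
  have unit: "\<exists>l. n dvd j * l - i" if j: "j \<in> {1, -1, u, -u}" for i j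
  proof -
    have "n dvd u * (k * i) - i" "n dvd (- u) * (- k * i) - i"
      using dvd_mult2[OF k, of i] by (simp_all add: algebra_simps)
    moreover have "n dvd 1 * i - i" "n dvd (-1) * (- i) - i" by simp_all
    ultimately show ?thesis using j by blast
  qed
  have u2: "\<not> n dvd 2 * u"
  proof
    assume "n dvd 2 * u"
    then have "n dvd 2 * u * k - 2 * (u * k - 1)"
      by (rule dvd_diff[OF dvd_mult2 dvd_mult[OF k]])
    then show False using nd(3) by (simp add: n_def algebra_simps)
  qed
  have u0: "\<not> n dvd u"
  proof
    assume "n dvd u"
    then have "n dvd 2 * u" by simp
    then show False using u2 by simp
  qed
  have n1: "\<not> n dvd 1" using nd(3) dvd_mult2[of n 1 2] by (auto simp: n_def)
  define f where "f i = x [^] (i::int)" for i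
  have eq: "f i = f j \<longleftrightarrow> n dvd j - i" for i j unfolding f_def n_def using int_pow_eq[OF x] by simp
  have dist: "distinct [f 0, f 1, f (-1), f u, f (-u)]"
  proof -
    have "\<not> n dvd - (u + 1)" "\<not> n dvd - (u - 1)" "\<not> n dvd - (2 * u)"
      unfolding dvd_minus_iff using nd(1,2) u2 by (simp_all add: n_def)
    moreover have "-1 - u = - (u + 1)" "- u - 1 = - (u + 1)" "- u + 1 = - (u - 1)" "- u - u = - (2 * u)"
      by simp_all
    ultimately have "\<not> n dvd -1 - u" "\<not> n dvd - u - 1" "\<not> n dvd - u + 1" "\<not> n dvd - u - u"
      by (metis, metis, metis, metis)
    moreover have "\<not> n dvd u - 1" "\<not> n dvd u + 1" "\<not> n dvd 2" using nd by (simp_all add: n_def)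
    ultimately show ?thesis using u0 n1 by (simp add: eq)
  qed
  have "{f i, f j} \<in> power_graph_edges G"
    if "i \<in> {0, 1, -1, u, -u}" "j \<in> {0, 1, -1, u, -u}" "f i \<noteq> f j" for i j
  proof (cases "j = 0")
    case True
    then have "f j = \<one>" by (simp add: f_def)
    then show ?thesis using one_edge[of "f i"] that x by (auto simp: f_def insert_commute)
  next
    case False
    then have "j \<in> {1, -1, u, -u}" using that(2) by simp
    from unit[OF this] obtain l where "n dvd j * l - i" by blast
    then have "f i \<in> generate G {f j}" using int_pow_mem_generate[OF x] by (simp add: f_def n_def)
    then show ?thesis using that x by (simp add: doubleton_power_graph_edges_iff f_def)
  qed
  then have "\<forall>y\<in>f ` {0, 1, -1, u, -u}. \<forall>z\<in>f ` {0, 1, -1, u, -u}. y \<noteq> z \<longrightarrow> {y, z} \<in> power_graph_edges G"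
    by blast
  then show ?thesis using dist unfolding image_insert image_empty by (intro exI conjI)
qed

text \<open>Every finite order from 5 on except 6 has a unit other than 1 and -1, so
  \<open>five_units_K5\<close> applies; order 6 and infinite order need their own exponents.\<close>

lemma power_graph_K5:
  assumes x: "x \<in> carrier G" and ord: "ord x \<notin> {1, 2, 3, 4}"
  shows "\<exists>a b c d e. distinct [a, b, c, d, e] \<and>
    (\<forall>y\<in>{a, b, c, d, e}. \<forall>z\<in>{a, b, c, d, e}. y \<noteq> z \<longrightarrow> {y, z} \<in> power_graph_edges G)"
proof -
  consider "ord x = 0" | "ord x = 6" | "odd (ord x)" "ord x \<ge> 5"
    | m where "ord x = 4 * m" "m \<ge> 2" | m where "ord x = 4 * m + 2" "m \<ge> 2"
  proof -
    have "ord x = 4 * (ord x div 4) + ord x mod 4" by simp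
    moreover have "ord x mod 4 < 4" by simp
    moreover have "ord x = 0 \<or> ord x \<ge> 5" using ord by auto
    ultimately have "ord x = 0 \<or> ord x = 6 \<or> (odd (ord x) \<and> ord x \<ge> 5) \<or>
        (ord x = 4 * (ord x div 4) \<and> ord x div 4 \<ge> 2) \<or> (ord x = 4 * (ord x div 4) + 2 \<and> ord x div 4 \<ge> 2)"
      by presburger
    then show thesis using that by blast
  qed
  then show ?thesis
  proof cases
    case 1
    define f where "f i = x [^] (i::int)" for i
    have eq: "f i = f j \<longleftrightarrow> i = j" for i j
      unfolding f_def using int_pow_eq[OF x] 1 by auto
    have g: "f i \<in> generate G {f j}" if "j dvd i" for i j
    proof -
      from that obtain k where "i = j * k" by blast
      then show ?thesis using int_pow_mem_generate[OF x, of j k i] by (simp add: f_def)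
    qed
    \<comment> \<open>These exponents are totally ordered by divisibility, with 0 divisible by
      all.\<close>
    have "{f i, f j} \<in> power_graph_edges G" if "i \<in> {0, 1, 2, 4, 8}" "j \<in> {0, 1, 2, 4, 8}" "f i \<noteq> f j" for i j
    proof -
      have "i dvd j \<or> j dvd i" using that by auto
      then show ?thesis using that g x by (auto simp: doubleton_power_graph_edges_iff f_def)
    qed
    then have "\<forall>y\<in>f ` {0, 1, 2, 4, 8}. \<forall>z\<in>f ` {0, 1, 2, 4, 8}.
      y \<noteq> z \<longrightarrow> {y, z} \<in> power_graph_edges G" by blast
    moreover have "distinct [f 0, f 1, f 2, f 4, f 8]" by (simp add: eq)
    ultimately show ?thesis unfolding image_insert image_empty by (intro exI conjI)
  next
    case 2
    define f where "f i = x [^] (i::int)" for i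
    have eq: "f i = f j \<longleftrightarrow> 6 dvd j - i" for i j
      unfolding f_def using int_pow_eq[OF x] 2 by simp
    have g: "f i \<in> generate G {f j}" if "6 dvd j * k - i" for i j k
      using that int_pow_mem_generate[OF x, of j k i] 2 by (simp add: f_def)
    \<comment> \<open>Modulo 6, the exponents 1 and 5 give generators, and 2 and 4 generate the same
      subgroup; only 3 is left out.\<close>
    have "{f i, f j} \<in> power_graph_edges G" if "i \<in> {0, 1, 2, 4, 5}" "j \<in> {0, 1, 2, 4, 5}" "f i \<noteq> f j" for i j
    proof -
      have "f i \<in> generate G {f j} \<or> f j \<in> generate G {f i}"
      proof -
        \<comment> \<open>The multipliers \<open>i\<close> and \<open>5 * i\<close> serve the
          generators 1 and 5, \<open>2\<close> exchanges 2 and 4, and \<open>0\<close> reaches the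
          identity.\<close>
        have "6 dvd j * i - i \<or> 6 dvd j * (5 * i) - i \<or> 6 dvd j * 2 - i \<or> 6 dvd j * 0 - i \<or>
          6 dvd i * j - j \<or> 6 dvd i * (5 * j) - j \<or> 6 dvd i * 2 - j \<or> 6 dvd i * 0 - j"
          using that(1,2) by (elim insertE emptyE) simp_all
        then show ?thesis using g by blast
      qed
      then show ?thesis using that x by (auto simp: doubleton_power_graph_edges_iff f_def)
    qed
    then have "\<forall>y\<in>f ` {0, 1, 2, 4, 5}. \<forall>z\<in>f ` {0, 1, 2, 4, 5}.
      y \<noteq> z \<longrightarrow> {y, z} \<in> power_graph_edges G" by blast
    moreover have "distinct [f 0, f 1, f 2, f 4, f 5]" by (simp add: eq)
    ultimately show ?thesis unfolding image_insert image_empty by (intro exI conjI)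
  next
    case 3
    show ?thesis
    proof (rule five_units_K5[OF x, of 2])
      show "coprime 2 (int (ord x))" using 3 by simp
      show "\<not> int (ord x) dvd 2 - 1" "\<not> int (ord x) dvd 2 + 1" "\<not> int (ord x) dvd 2"
        using 3 zdvd_imp_le[of "int (ord x)" 1] zdvd_imp_le[of "int (ord x)" 3] zdvd_imp_le[of "int (ord x)" 2]
        by auto
    qed
  next
    case (4 m)
    \<comment> \<open>Half the order minus 1. It is a unit because
      \<open>?u * ?u - 4 * int m * (int m - 1)\<close> equals 1.\<close>
    let ?u = "2 * int m - 1"
    show ?thesis
    proof (rule five_units_K5[OF x, of ?u])
      have "coprime ?u (4 * int m)"
      proof (rule coprimeI)
        fix c assume "c dvd ?u" "c dvd 4 * int m"
        then have "c dvd ?u * ?u - 4 * int m * (int m - 1)" by (metis dvd_diff dvd_mult2)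
        then show "is_unit c" by (simp add: algebra_simps)
      qed
      then show "coprime ?u (int (ord x))" using 4 by simp
      show "\<not> int (ord x) dvd ?u - 1" "\<not> int (ord x) dvd ?u + 1" "\<not> int (ord x) dvd 2"
        using 4 zdvd_imp_le[of "int (ord x)" "?u - 1"] zdvd_imp_le[of "int (ord x)" "?u + 1"]
          zdvd_imp_le[of "int (ord x)" 2] by auto
    qed
  next
    case (5 m)
    \<comment> \<open>Half the order minus 2, as half the order is odd here and its predecessor
      even. A common divisor with the order divides 4, and \<open>?u\<close> is odd.\<close>
    let ?u = "2 * int m - 1"
    show ?thesis
    proof (rule five_units_K5[OF x, of ?u])
      have "coprime ?u (4 * int m + 2)"
      proof (rule coprimeI)
        fix c assume c: "c dvd ?u" "c dvd 4 * int m + 2"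
        then have "c dvd 4 * int m + 2 - 2 * ?u" by (metis dvd_diff dvd_mult)
        then have c4: "c dvd 4" by simp
        have "coprime ?u 4"
        proof -
          have "coprime ?u (2 ^ 2)" by (intro coprime_power_right_iff[THEN iffD2]) simp
          then show ?thesis by simp
        qed
        with c(1) c4 show "is_unit c" using coprime_common_divisor by blast
      qed
      moreover have ord_x: "int (ord x) = 4 * int m + 2" using 5 by simp
      ultimately show "coprime ?u (int (ord x))" by metis
      show "\<not> int (ord x) dvd ?u - 1" "\<not> int (ord x) dvd ?u + 1" "\<not> int (ord x) dvd 2"
        using 5(2) zdvd_imp_le[of "int (ord x)" "?u - 1"] zdvd_imp_le[of "int (ord x)" "?u + 1"]
          zdvd_imp_le[of "int (ord x)" 2] unfolding ord_x by auto
    qed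
  qed
qed

lemma square_eq_pow: "x \<in> carrier G \<Longrightarrow> x \<otimes> x = x [^] (2::int)"
  using int_pow_mult[of x 1 1] by simp

lemma inv_eq_pow: "x \<in> carrier G \<Longrightarrow> inv x = x [^] (-1::int)"
  by (simp add: int_pow_neg)

lemma square_order_4:
  assumes "x \<in> carrier G" "ord x = 4"
  shows "ord (x \<otimes> x) = 2" "inv x \<noteq> x" "inv x \<otimes> inv x = x \<otimes> x" "x \<otimes> x \<noteq> x" "x \<otimes> x \<noteq> inv x"
proof -
  have eq: "x [^] i = x [^] j \<longleftrightarrow> 4 dvd j - i" for i j :: int
    using int_pow_eq[OF assms(1)] assms(2) by simp
  have "(x \<otimes> x) [^] n = \<one> \<longleftrightarrow> 2 dvd n" for n :: nat
  proof -
    have "(x \<otimes> x) [^] n = x [^] (2 * int n)"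
      using assms(1) int_pow_pow[of x 2 "int n"] by (simp add: square_eq_pow int_pow_int)
    also have "\<dots> = \<one> \<longleftrightarrow> 4 dvd 2 * int n" using eq[of "2 * int n" 0] by simp
    also have "\<dots> \<longleftrightarrow> 2 dvd n" by presburger
    finally show ?thesis .
  qed
  then show "ord (x \<otimes> x) = 2" using ord_unique[of "x \<otimes> x" 2] assms(1) by simp
  have x1: "x = x [^] (1::int)" using assms(1) by simp
  show "inv x \<noteq> x" using eq[of "-1" 1] inv_eq_pow[OF assms(1)] x1 by simp
  have "inv x \<otimes> inv x = x [^] (-2::int)"
    using int_pow_mult[OF assms(1), of "-1" "-1"] inv_eq_pow[OF assms(1)] by simp
  then show "inv x \<otimes> inv x = x \<otimes> x" using eq[of "-2" 2] square_eq_pow[OF assms(1)] by simp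
  show "x \<otimes> x \<noteq> x" using eq[of 2 1] square_eq_pow[OF assms(1)] x1 by simp
  show "x \<otimes> x \<noteq> inv x" using eq[of 2 "-1"] square_eq_pow[OF assms(1)] inv_eq_pow[OF assms(1)] by simp
qed

lemma inv_order_3:
  assumes "x \<in> carrier G" "ord x = 3"
  shows "inv x \<noteq> x" 
proof -
  have "x [^] (-1::int) \<noteq> x [^] (1::int)" using int_pow_eq[OF assms(1), of "-1" 1] assms(2) by simp
  then show ?thesis using assms(1) inv_eq_pow by simp
qed

text \<open>Modulo an order of at most 4 every exponent is congruent to 0, 1, -1 or 2.\<close>

lemma generate_order_le_4:
  assumes y: "y \<in> carrier G" and ord: "ord y \<in> {1, 2, 3, 4}" and x: "x \<in> generate G {y}"
  shows "x = \<one> \<or> x = y \<or> (ord y = 3 \<and> x = inv y) \<or> (ord y = 4 \<and> (x = inv y \<or> x = y \<otimes> y))"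
proof -
  obtain k where k: "x = y [^] (k::int)" using x y by (auto simp: generate_pow)
  have eq: "x = y [^] j \<longleftrightarrow> int (ord y) dvd j - k" for j
    unfolding k using int_pow_eq[OF y] by simp
  have "int (ord y) dvd 0 - k \<or> int (ord y) dvd 1 - k \<or> (ord y = 3 \<and> int (ord y) dvd -1 - k) \<or>
      (ord y = 4 \<and> (int (ord y) dvd -1 - k \<or> int (ord y) dvd 2 - k))"
    using ord by (elim insertE emptyE; simp; presburger)
  then show ?thesis
    unfolding eq[symmetric] using y by (simp add: square_eq_pow inv_eq_pow)
qed

text \<open>Without the identity the graph falls into single edges (order 3), isolated involutions,
  and windmills: triangles \<open>w\<close>, \<open>inv w\<close>, \<open>w \<otimes> w\<close> that
  share the involution. The layout and all arguments for non-adjacency rest on this.\<close>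

lemma nonidentity_edge_cases:
  assumes ords: "\<And>x. x \<in> carrier G \<Longrightarrow> ord x \<in> {1, 2, 3, 4}"
    and e: "{x, y} \<in> power_graph_edges G" and "x \<noteq> \<one>" "y \<noteq> \<one>"
  shows "(ord x = 3 \<and> y = inv x) \<or> (ord x = 4 \<and> y = inv x) \<or>
     (ord x = 4 \<and> y = x \<otimes> x) \<or> (ord y = 4 \<and> x = y \<otimes> y)"
proof -
  have xy: "x \<in> carrier G" "y \<in> carrier G" "x \<noteq> y" "x \<in> generate G {y} \<or> y \<in> generate G {x}"
    using e by (auto simp: doubleton_power_graph_edges_iff)
  from xy(4) show ?thesis
  proof
    assume "x \<in> generate G {y}"
    from generate_order_le_4[OF xy(2) ords[OF xy(2)] this]
    show ?thesis using xy(1-3) assms(3) ord_inv[OF xy(2)] inv_inv[OF xy(2)] by metis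
  next
    assume "y \<in> generate G {x}"
    from generate_order_le_4[OF xy(1) ords[OF xy(1)] this]
    show ?thesis using xy(3) assms(4) by metis
  qed
qed

lemma order_4_edges:
  assumes x: "x \<in> carrier G" "ord x = 4"
  shows "{x, inv x} \<in> power_graph_edges G" "{x, x \<otimes> x} \<in> power_graph_edges G"
    "{inv x, x \<otimes> x} \<in> power_graph_edges G"
proof -
  have *: "{y, y \<otimes> y} \<in> power_graph_edges G" if "y \<in> carrier G" "ord y = 4" for y
    using that square_order_4[OF that] int_pow_mem_generate[of y 1 2 2]
    by (simp add: doubleton_power_graph_edges_iff square_eq_pow)
  show "{x, inv x} \<in> power_graph_edges G"
    using x square_order_4[OF x] int_pow_mem_generate[of x 1 "-1" "-1"]
    by (auto simp: doubleton_power_graph_edges_iff inv_eq_pow)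
  show "{x, x \<otimes> x} \<in> power_graph_edges G" using * x by blast
  show "{inv x, x \<otimes> x} \<in> power_graph_edges G"
    using *[of "inv x"] x square_order_4[OF x] ord_inv[OF x(1)] by simp
qed

lemma cyclic_groupI:
  assumes "x \<in> carrier G" "carrier G \<subseteq> range (\<lambda>n::int. x [^] n)"
  shows "cyclic_group G"
  unfolding cyclic_group using assms by auto

text \<open>Only \<open>g \<otimes> g\<close> can fail to be the identity or one of the generators
  \<open>g\<close>, \<open>inv g\<close>, so of two distinct elements one is adjacent to
  everything.\<close>

lemma power_graph_complete_cyclic:
  assumes "cyclic_group G" "finite (carrier G)" "order G \<le> 4"
    and xy: "x \<in> carrier G" "y \<in> carrier G" "x \<noteq> y"
  shows "{x, y} \<in> power_graph_edges G"
proof -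
  obtain g where g: "g \<in> carrier G" "carrier G = range (\<lambda>n::int. g [^] n)"
    using assms(1) cyclic_group by blast
  have gen: "generate G {g} = carrier G" using g by (auto simp: generate_pow)
  have "ord g \<noteq> 0" using g(1) assms(2) by (metis ord_ge_1 not_one_le_zero)
  moreover have "ord g \<le> 4" using g(1) assms(2,3) by (metis ord_le_group_order order_trans)
  ultimately have ord: "ord g \<in> {1, 2, 3, 4}" by auto
  have gen_inv: "generate G {inv g} = carrier G"
  proof
    show "generate G {inv g} \<subseteq> carrier G" using g(1) generate_incl by simp
    show "carrier G \<subseteq> generate G {inv g}"
    proof
      fix z assume "z \<in> carrier G"
      then obtain n where "z = g [^] (n::int)" using g(2) by blast
      then show "z \<in> generate G {inv g}"
        using int_pow_mem_generate[OF g(1), of "-1" "-n" n] inv_eq_pow[OF g(1)] by simp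
    qed
  qed
  have "z = \<one> \<or> z = g \<or> z = inv g \<or> z = g \<otimes> g" if "z \<in> carrier G" for z
    using generate_order_le_4[OF g(1) ord, of z] gen that by blast
  then show ?thesis
    using xy gen gen_inv generate.one[of G] by (metis doubleton_power_graph_edges_iff)
qed

end

subsection \<open>Redrawing the power graph\<close>

definition crossing :: "real \<times> real \<Rightarrow> real \<times> real \<Rightarrow> bool" where
  "crossing i j \<longleftrightarrow> fst i < fst j \<and> fst j < snd i \<and> snd i < snd j"

text \<open>Block \<open>k\<close> runs from 5 + k to 6 + k; the 5 keeps it clear of (-4, 4), where
  order 3 is placed. The fraction fits infinitely many positions into the block, and the 2 in it
  keeps the first position off the next block.\<close>

definition root_pos :: "nat \<Rightarrow> nat \<Rightarrow> real" where
  "root_pos k m = 5 + real k + 1 / (real m + 2)"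

lemma root_pos_bounds: "5 + real k < root_pos k m" "root_pos k m < 6 + real k"
  by (auto simp: root_pos_def field_simps)

lemma root_pos_less_iff: "root_pos k m < root_pos k' m' \<longleftrightarrow> k < k' \<or> k = k' \<and> m' < m"
proof -
  consider "k < k'" | "k' < k" | "k = k'" by linarith
  then show ?thesis
  proof cases
    case 1
    then have "real k + 1 \<le> real k'" by linarith
    then show ?thesis using 1 root_pos_bounds[of k m] root_pos_bounds[of k' m'] by simp
  next
    case 2
    then have "real k' + 1 \<le> real k" by linarith
    then show ?thesis using 2 root_pos_bounds[of k m] root_pos_bounds[of k' m'] by simp
  next
    case 3
    have "1 / (real m + 2) < 1 / (real m' + 2) \<longleftrightarrow> m' < m" by (simp add: divide_simps)
    with 3 show ?thesis by (simp add: root_pos_def)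
  qed
qed

lemma root_pos_eq_iff: "root_pos k m = root_pos k' m' \<longleftrightarrow> k = k' \<and> m = m'"
  by (metis less_irrefl linorder_neqE_nat root_pos_less_iff)

lemma less_pos_iff: "5 + real k < root_pos k' m \<longleftrightarrow> k \<le> k'"
proof
  assume "5 + real k < root_pos k' m"
  then have "real k < real k' + 1" using root_pos_bounds(2)[of k' m] by linarith
  then show "k \<le> k'" by linarith
qed (use root_pos_bounds(1)[of k' m] in simp)

lemma root_pos_less_real_iff: "root_pos k m < 5 + real k' \<longleftrightarrow> k < k'"
proof
  assume "k < k'"
  then have "real k + 1 \<le> real k'" by linarith
  then show "root_pos k m < 5 + real k'" using root_pos_bounds(2)[of k m] by linarith
next
  assume "root_pos k m < 5 + real k'"
  then show "k < k'" using root_pos_bounds(1)[of k m] by linarith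
qed

lemma neg_less_pos: "0 < t \<Longrightarrow> - t < root_pos k m" "t < 4 \<Longrightarrow> t < root_pos k m" "t < 4 \<Longrightarrow> \<not> root_pos k m < t"
  "0 < t \<Longrightarrow> \<not> root_pos k m < - t"
  using root_pos_bounds(1)[of k m] by auto

lemmas root_pos_simps = root_pos_less_iff less_pos_iff root_pos_less_real_iff neg_less_pos

text \<open>\<open>(k, n) \<in> M\<close> stands for an inverse pair of square roots in block
  \<open>k\<close>, at the positions \<open>2 * n + 1\<close> and \<open>2 * n\<close>, the odd one
  on the left because \<open>root_pos\<close> decreases. It contributes the three sides of a
  triangle.\<close>

definition edge_intervals :: "real set \<Rightarrow> (nat \<times> nat) set \<Rightarrow> (real \<times> real) set" where
  "edge_intervals T M = {(- t, t) | t. t \<in> T} \<union> {(root_pos k (2 * n + 1), root_pos k (2 * n)) | k n. (k, n) \<in> M} \<union>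
     {(5 + real k, root_pos k (2 * n + i)) | k n i. (k, n) \<in> M \<and> i < 2}"

lemma edge_intervalsE:
  assumes "i \<in> edge_intervals T M"
  obtains t where "t \<in> T" "i = (- t, t)"
  | k n where "(k, n) \<in> M" "i = (root_pos k (2 * n + 1), root_pos k (2 * n))"
  | k n j where "(k, n) \<in> M" "j < 2" "i = (5 + real k, root_pos k (2 * n + j))"
  using assms unfolding edge_intervals_def by blast

text \<open>Symmetric intervals are nested and stay in (-4, 4), and blocks are disjoint. In a block,
  the intervals from the centre share their left end, and no position lies between the two of a
  pair.\<close>

lemma edge_intervals_not_crossing:
  assumes "T \<subseteq> {0<..<4}" "i \<in> edge_intervals T M" "j \<in> edge_intervals T M"
  shows "\<not> crossing i j"
  using assms(2)
proof (cases rule: edge_intervalsE)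
  case (1 t)
  have t: "0 < t" "t < 4" using 1 assms(1) by auto
  from assms(3) show ?thesis
  proof (cases rule: edge_intervalsE)
    case (1 t')
    then show ?thesis using t \<open>i = (- t, t)\<close> by (auto simp: crossing_def)
  next
    case 2
    then show ?thesis using t \<open>i = (- t, t)\<close> by (auto simp: crossing_def root_pos_simps)
  next
    case 3
    then show ?thesis using t \<open>i = (- t, t)\<close> by (auto simp: crossing_def root_pos_simps)
  qed
next
  case i: (2 k n)
  from assms(3) show ?thesis
  proof (cases rule: edge_intervalsE)
    case (1 t')
    then have "0 < t'" using assms(1) by auto
    with 1 i show ?thesis by (auto simp: crossing_def root_pos_simps)
  next
    case 2
    then show ?thesis using i by (auto simp: crossing_def root_pos_simps)
  next
    case 3
    then show ?thesis using i by (auto simp: crossing_def root_pos_simps)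
  qed
next
  case i: (3 k n l)
  from assms(3) show ?thesis
  proof (cases rule: edge_intervalsE)
    case (1 t')
    then have "0 < t'" using assms(1) by auto
    with 1 i show ?thesis by (auto simp: crossing_def root_pos_simps)
  next
    case 2
    then show ?thesis using i by (auto simp: crossing_def root_pos_simps)
  next
    case 3
    then show ?thesis using i by (auto simp: crossing_def root_pos_simps)
  qed
qed

text \<open>A crossing would need an interval of the family with some \<open>5 + real k\<close>
  strictly inside, and there is none.\<close>

lemma edge_intervals_not_crossing_centres:
  assumes "T \<subseteq> {0<..<4}" "i \<in> edge_intervals T M" "j = (5 + real k, 5 + real k')"
  shows "\<not> crossing i j" "\<not> crossing j i"
  using assms(2) assms(1) unfolding assms(3)
  by (cases rule: edge_intervalsE; force simp: crossing_def root_pos_simps)+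

text \<open>The chord joins the left ends of \<open>(- s, s)\<close> and \<open>(- r, r)\<close>;
  only a symmetric interval with radius strictly between could cross it.\<close>

lemma edge_intervals_not_crossing_pairs:
  assumes "T \<subseteq> {0<..<4}" "i \<in> edge_intervals T M" "j = (- s, - r)" "0 < r" "r < s"
    "\<And>t. t \<in> T \<Longrightarrow> \<not> (r < t \<and> t < s)"
  shows "\<not> crossing i j" "\<not> crossing j i"
proof -
  have "\<not> crossing i j \<and> \<not> crossing j i"
    using assms(2)
  proof (cases rule: edge_intervalsE)
    case (1 t)
    then show ?thesis using assms(1,3-5) assms(6)[of t] by (auto simp: crossing_def)
  next
    case (2 k n)
    then show ?thesis using root_pos_bounds(1)[of k "2 * n + 1"] assms by (auto simp: crossing_def)
  next
    case (3 k n l)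
    then show ?thesis using assms by (auto simp: crossing_def)
  qed
  then show "\<not> crossing i j" "\<not> crossing j i" by auto
qed

text \<open>Pair \<open>q\<close> lies left of pair \<open>p\<close>, and the chord runs from the
  right root of \<open>q\<close> to the left root of \<open>p\<close>, so only a pair strictly
  between them could interfere.\<close>

lemma edge_intervals_not_crossing_blades:
  assumes "T \<subseteq> {0<..<4}" "i \<in> edge_intervals T M" "j = (root_pos k (2 * q), root_pos k (2 * p + 1))" "p < q"
    "\<And>n. (k, n) \<in> M \<Longrightarrow> \<not> (p < n \<and> n < q)"
  shows "\<not> crossing i j" "\<not> crossing j i"
proof -
  have "\<not> crossing i j \<and> \<not> crossing j i"
    using assms(2)
  proof (cases rule: edge_intervalsE)
    case (1 t)
    then have "0 < t" "t < 4" using assms(1) by auto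
    with 1 show ?thesis unfolding assms(3) by (auto simp: crossing_def root_pos_simps)
  next
    case (2 k' n)
    then show ?thesis unfolding assms(3) using assms(4) assms(5)[of n] by (auto simp: crossing_def root_pos_simps)
  next
    case (3 k' n l)
    have "p < n \<and> n < q" if "2 * n + l < 2 * q" "2 * p + 1 < 2 * n + l" using that 3(2) by linarith
    with 3 show ?thesis unfolding assms(3) using assms(4) assms(5)[of n] by (auto simp: crossing_def root_pos_simps)
  qed
  then show "\<not> crossing i j" "\<not> crossing j i" by auto
qed

section \<open>Placing the group elements on the line\<close>

lemma max_pair_eq_iff:
  fixes f :: "'a \<Rightarrow> 'b::linorder"
  assumes "inj_on f A" "x \<in> A" "x' \<in> A" "y \<in> A" "y' \<in> A" "max (f x) (f x') = max (f y) (f y')"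
  shows "x = y \<or> x = y' \<or> x' = y \<or> x' = y'"
  using assms by (auto simp: max_def inj_on_eq_iff split: if_splits)

text \<open>Countability enters through \<open>\<kappa>\<close> and \<open>\<nu>\<close>;
  \<open>\<iota>\<close> is real-valued because order 2 and order 3 may occur uncountably often.
  \<open>K\<close> may exceed the set of squares, so that chosen involutions can be given integer
  places.\<close>

locale power_graph_layout = group +
  fixes \<iota> :: "'a \<Rightarrow> real" and K :: "'a set" and \<kappa> \<nu> :: "'a \<Rightarrow> nat"
  assumes ords: "\<And>x. x \<in> carrier G \<Longrightarrow> ord x \<in> {1, 2, 3, 4}"
    and inj_\<iota>: "inj_on \<iota> (carrier G)" and \<iota>_range: "\<And>x. x \<in> carrier G \<Longrightarrow> 0 < \<iota> x \<and> \<iota> x < 4"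
    and K: "K \<subseteq> {x \<in> carrier G. ord x = 2}" and inj_\<kappa>: "inj_on \<kappa> K"
    and squares: "\<And>x. \<lbrakk>x \<in> carrier G; ord x = 4\<rbrakk> \<Longrightarrow> x \<otimes> x \<in> K"
    and inj_\<nu>: "inj_on \<nu> {x \<in> carrier G. ord x = 4}"
begin

text \<open>\<open>\<tau>\<close> and \<open>\<mu>\<close> label inverse pairs: a maximum is
  invariant under inversion, and by injectivity it still determines the pair.\<close>

definition \<tau> :: "'a \<Rightarrow> real" where "\<tau> g = max (\<iota> g) (\<iota> (inv g))"
definition \<mu> :: "'a \<Rightarrow> nat" where "\<mu> g = max (\<nu> g) (\<nu> (inv g))"

text \<open>An order-3 pair sits symmetrically about \<open>0\<close>. The involution \<open>z \<in> K\<close> sits at an integer, and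
  its square roots follow in \<open>(5 + \<kappa> z, 6 + \<kappa> z)\<close>, a root next to its inverse. The other involutions
  have no edges except to the identity and sit anywhere.\<close>

definition layout :: "'a \<Rightarrow> real" where
  "layout g =
    (if ord g = 2 then (if g \<in> K then 5 + real (\<kappa> g) else \<iota> g - 20)
     else if ord g = 3 then (if \<iota> g < \<iota> (inv g) then \<tau> g else - \<tau> g)
     else root_pos (\<kappa> (g \<otimes> g)) (2 * \<mu> g + (if \<nu> g < \<nu> (inv g) then 0 else 1)))"

definition thirds :: "real set" where "thirds = \<tau> ` {x \<in> carrier G. ord x = 3}"
definition fourths :: "(nat \<times> nat) set" where
  "fourths = (\<lambda>x. (\<kappa> (x \<otimes> x), \<mu> x)) ` {x \<in> carrier G. ord x = 4}"

lemma thirds_range: "thirds \<subseteq> {0<..<4}"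
  using \<iota>_range by (auto simp: thirds_def \<tau>_def less_max_iff_disj)

lemma \<tau>_inv: "x \<in> carrier G \<Longrightarrow> \<tau> (inv x) = \<tau> x"
  by (simp add: \<tau>_def max.commute)

lemma \<mu>_inv: "x \<in> carrier G \<Longrightarrow> \<mu> (inv x) = \<mu> x"
  by (simp add: \<mu>_def max.commute)

lemma \<tau>_eqD:
  assumes "x \<in> carrier G" "y \<in> carrier G" "\<tau> x = \<tau> y"
  shows "y = x \<or> y = inv x"
  using max_pair_eq_iff[OF inj_\<iota>, of x "inv x" y "inv y"] assms by (auto simp: \<tau>_def)

lemma \<mu>_eqD:
  assumes "x \<in> carrier G" "ord x = 4" "y \<in> carrier G" "ord y = 4" "\<mu> x = \<mu> y"
  shows "y = x \<or> y = inv x"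
  using max_pair_eq_iff[OF inj_\<nu>, of x "inv x" y "inv y"] assms by (auto simp: \<mu>_def)

lemma \<iota>_inv_neq: "\<lbrakk>x \<in> carrier G; ord x = 3\<rbrakk> \<Longrightarrow> \<iota> (inv x) \<noteq> \<iota> x"
  using inj_on_eq_iff[OF inj_\<iota>, of x "inv x"] inv_order_3[of x] by auto

lemma \<nu>_inv_neq: "\<lbrakk>x \<in> carrier G; ord x = 4\<rbrakk> \<Longrightarrow> \<nu> (inv x) \<noteq> \<nu> x"
  using inj_on_eq_iff[OF inj_\<nu>, of x "inv x"] square_order_4(2)[of x] by auto

lemma layout_order_3:
  assumes "x \<in> carrier G" "ord x = 3"
  shows "layout x \<in> {\<tau> x, - \<tau> x}" "layout (inv x) = - layout x"
  using assms \<iota>_inv_neq[OF assms] by (auto simp: layout_def \<tau>_inv)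

lemma layout_order_4:
  assumes "x \<in> carrier G" "ord x = 4"
  shows "\<exists>i<2. layout x = root_pos (\<kappa> (x \<otimes> x)) (2 * \<mu> x + i)"
    "\<nu> x < \<nu> (inv x) \<Longrightarrow> layout x = root_pos (\<kappa> (x \<otimes> x)) (2 * \<mu> x)"
    "\<nu> (inv x) < \<nu> x \<Longrightarrow> layout x = root_pos (\<kappa> (x \<otimes> x)) (2 * \<mu> x + 1)"
proof -
  show "\<exists>i<2. layout x = root_pos (\<kappa> (x \<otimes> x)) (2 * \<mu> x + i)"
    using assms by (intro exI[of _ "if \<nu> x < \<nu> (inv x) then 0 else 1"]) (simp add: layout_def)
qed (use assms in \<open>simp_all add: layout_def\<close>)

text \<open>The orders occupy separate places: (-20, -16) for involutions outside \<open>K\<close>,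
  (-4, 4) for order 3, and from 5 on integers for \<open>K\<close> and non-integers for order 4.
  Within order 3 or 4 the label determines the pair, and the two members of a pair have different
  places.\<close>

lemma inj_layout: "inj_on layout (carrier G - {\<one>})"
proof (rule inj_onI)
  have distinct_orders: False
    if A: "x \<in> carrier G" "y \<in> carrier G" "ord x \<in> {2, 3, 4}" "ord y \<in> {2, 3, 4}"
      "ord x < ord y" "layout x = layout y" for x y
  proof -
    have t: "\<tau> z \<in> {0<..<4}" if "z \<in> carrier G" "ord z = 3" for z
      using thirds_range that by (auto simp: thirds_def)
    have t3: "\<bar>layout z\<bar> < 4" if "z \<in> carrier G" "ord z = 3" for z
      using t[OF that] layout_order_3(1)[OF that] by auto
    have t2: "layout z \<ge> 5 \<or> layout z < - 16" if "z \<in> carrier G" "ord z = 2" for z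
      using that(2) \<iota>_range[OF that(1)] by (simp add: layout_def)
    from A(3-5) consider "ord x = 2" "ord y = 3" | "ord x = 2" "ord y = 4" | "ord x = 3" "ord y = 4" by auto
    then show False
    proof cases
      case 1
      then show False using t2[OF A(1) 1(1)] t3[OF A(2) 1(2)] A(6) by linarith
    next
      case 2
      obtain i where i: "layout y = root_pos (\<kappa> (y \<otimes> y)) (2 * \<mu> y + i)"
        using layout_order_4(1)[OF A(2) 2(2)] by blast
      show False
      proof (cases "x \<in> K")
        case True
        then have "5 + real (\<kappa> x) = root_pos (\<kappa> (y \<otimes> y)) (2 * \<mu> y + i)"
          using i A(6) 2 by (simp add: layout_def)
        then show False
          using less_pos_iff[of "\<kappa> x" "\<kappa> (y \<otimes> y)" "2 * \<mu> y + i"]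
            root_pos_less_real_iff[of "\<kappa> (y \<otimes> y)" "2 * \<mu> y + i" "\<kappa> x"] by simp
      next
        case False
        then show False
          using i A(6) 2 root_pos_bounds(1)[of "\<kappa> (y \<otimes> y)" "2 * \<mu> y + i"] \<iota>_range[OF A(1)]
          by (simp add: layout_def)
      qed
    next
      case 3
      obtain i where i: "layout y = root_pos (\<kappa> (y \<otimes> y)) (2 * \<mu> y + i)"
        using layout_order_4(1)[OF A(2) 3(2)] by blast
      then show False
        using t3[OF A(1) 3(1)] A(6) root_pos_bounds(1)[of "\<kappa> (y \<otimes> y)" "2 * \<mu> y + i"] by linarith
    qed
  qed
  fix x y assume xy: "x \<in> carrier G - {\<one>}" "y \<in> carrier G - {\<one>}" "layout x = layout y"
  then have ox: "ord x \<in> {2, 3, 4}" and oy: "ord y \<in> {2, 3, 4}"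
    using ords[of x] ords[of y] ord_eq_1[of x] ord_eq_1[of y] by auto
  then have o: "ord x = ord y" using distinct_orders[of x y] distinct_orders[of y x] xy by force
  from ox consider "ord x = 2" | "ord x = 3" | "ord x = 4" by blast
  then show "x = y"
  proof cases
    case 1
    then show ?thesis
      using xy o inj_on_eq_iff[OF inj_\<kappa>, of x y] inj_on_eq_iff[OF inj_\<iota>, of x y] \<iota>_range[of x] \<iota>_range[of y]
      by (auto simp: layout_def split: if_splits)
  next
    case 2
    then have t: "\<tau> x > 0" "\<tau> y > 0" using xy o thirds_range by (auto simp: thirds_def)
    then have "\<tau> x = \<tau> y" using 2 o xy layout_order_3(1)[of x] layout_order_3(1)[of y] by auto
    then consider "y = x" | "y = inv x" using \<tau>_eqD xy by blast
    then show ?thesis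
      using 2 t xy layout_order_3[of x] by cases auto
  next
    case 3
    then have "\<mu> x = \<mu> y"
      using layout_order_4(1)[of x] layout_order_4(1)[of y] o xy by (auto simp: root_pos_eq_iff)
    then consider "y = x" | "y = inv x" using \<mu>_eqD 3 o xy by auto
    then show ?thesis
    proof cases
      case 2
      have "\<nu> (inv x) \<noteq> \<nu> x" using \<nu>_inv_neq 3 xy by blast
      then consider "\<nu> x < \<nu> (inv x)" | "\<nu> (inv x) < \<nu> x" by linarith
      then show ?thesis
        using layout_order_4(2,3)[of x] layout_order_4(2,3)[of "inv x"] 2 3 xy o \<mu>_inv[of x]
        by cases (auto simp: root_pos_eq_iff)
    qed simp
  qed
qed

lemma layout_edge:
  assumes e: "{x, y} \<in> power_graph_edges G" and "x \<noteq> \<one>" "y \<noteq> \<one>" and less: "layout x < layout y"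
  shows "(layout x, layout y) \<in> edge_intervals thirds fourths"
proof -
  have xy: "x \<in> carrier G" "y \<in> carrier G" using e by (auto simp: doubleton_power_graph_edges_iff)
  have square: "(layout (w \<otimes> w), layout w) \<in> edge_intervals thirds fourths \<and> layout (w \<otimes> w) < layout w"
    if w: "w \<in> carrier G" "ord w = 4" for w
  proof -
    have "layout (w \<otimes> w) = 5 + real (\<kappa> (w \<otimes> w))"
      using square_order_4(1)[OF w] squares[OF w] by (simp add: layout_def)
    moreover obtain i where "i < 2" "layout w = root_pos (\<kappa> (w \<otimes> w)) (2 * \<mu> w + i)"
      using layout_order_4(1)[OF w] by blast
    moreover have "(\<kappa> (w \<otimes> w), \<mu> w) \<in> fourths" using w by (auto simp: fourths_def)
    ultimately show ?thesis unfolding edge_intervals_def by (auto simp: less_pos_iff)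
  qed
  consider "ord x = 3" "y = inv x" | "ord x = 4" "y = inv x" | "ord x = 4" "y = x \<otimes> x"
    | "ord y = 4" "x = y \<otimes> y"
    using nonidentity_edge_cases[OF ords e assms(2,3)] by blast
  then show ?thesis
  proof cases
    case 1
    have "\<tau> x \<in> thirds" using 1 xy by (auto simp: thirds_def)
    moreover from this have "\<tau> x > 0" using thirds_range by auto
    then have "layout x = - \<tau> x" "layout y = \<tau> x"
      using layout_order_3[OF xy(1) 1(1)] less 1 by auto
    ultimately show ?thesis by (auto simp: edge_intervals_def)
  next
    case 2
    have iy: "inv y = x" "ord y = 4" using 2 xy by simp_all
    have sq: "y \<otimes> y = x \<otimes> x" "\<mu> y = \<mu> x" using 2 square_order_4(3)[OF xy(1)] \<mu>_inv xy by simp_all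
    \<comment> \<open>The partner with the smaller \<open>\<nu>\<close> has the even index and hence
      the right-hand place, so \<open>layout x < layout y\<close> tells which of the two
      \<open>x\<close> is.\<close>
    have "\<not> \<nu> x < \<nu> (inv x)"
    proof
      assume *: "\<nu> x < \<nu> (inv x)"
      then have "layout y = root_pos (\<kappa> (x \<otimes> x)) (2 * \<mu> x + 1)"
        using layout_order_4(3)[OF xy(2) iy(2)] sq iy 2 by simp
      with layout_order_4(2)[OF xy(1) 2(1) *] less show False by (simp add: root_pos_less_iff)
    qed
    then have *: "\<nu> (inv x) < \<nu> x" using \<nu>_inv_neq[OF xy(1) 2(1)] by linarith
    then have "layout y = root_pos (\<kappa> (x \<otimes> x)) (2 * \<mu> x)"
      using layout_order_4(2)[OF xy(2) iy(2)] sq iy 2 by simp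
    moreover note layout_order_4(3)[OF xy(1) 2(1) *]
    moreover have "(\<kappa> (x \<otimes> x), \<mu> x) \<in> fourths" using xy 2 by (auto simp: fourths_def)
    ultimately show ?thesis unfolding edge_intervals_def by auto
  next
    case 3
    then show ?thesis using square[OF xy(1)] less by simp
  next
    case 4
    then show ?thesis using square[OF xy(2)] by simp
  qed
qed

text \<open>The old chords do not cross each other, and the edges at the identity are drawn below
  the line, so only the new chord has to be tested.\<close>

lemma planar_insert_edge:
  assumes ab: "a \<in> carrier G - {\<one>}" "b \<in> carrier G - {\<one>}" and less: "layout a < layout b"
    and nc: "\<And>i. i \<in> edge_intervals thirds fourths \<Longrightarrow>
      \<not> crossing i (layout a, layout b) \<and> \<not> crossing (layout a, layout b) i"
  shows "planar (carrier G) (insert {a, b} (power_graph_edges G))"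
proof (rule planar_apex_noncrossing[where \<sigma> = layout and v = \<one>])
  show "simple_graph (carrier G) (insert {a, b} (power_graph_edges G))"
    using simple_graph_power_graph[of G] ab less by (auto simp: simple_graph_def card_2_iff)
  show "inj_on layout (carrier G - {\<one>})" by (rule inj_layout)
  have int: "(layout x, layout y) \<in> insert (layout a, layout b) (edge_intervals thirds fourths)"
    if "{x, y} \<in> {e \<in> insert {a, b} (power_graph_edges G). \<one> \<notin> e}" "layout x < layout y" for x y
  proof (cases "{x, y} = {a, b}")
    case True
    then show ?thesis using that less by (auto simp: doubleton_eq_iff)
  next
    case False
    then show ?thesis using that layout_edge[of x y] by auto
  qed
  have "\<not> crossing i j" if "i \<in> insert (layout a, layout b) (edge_intervals thirds fourths)"
    "j \<in> insert (layout a, layout b) (edge_intervals thirds fourths)" for i j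
  proof -
    have "\<not> crossing (layout a, layout b) (layout a, layout b)" by (simp add: crossing_def)
    then show ?thesis using that nc edge_intervals_not_crossing[OF thirds_range] by blast
  qed
  note nc' = this
  show "noncrossing layout {e \<in> insert {a, b} (power_graph_edges G). \<one> \<notin> e}"
    unfolding noncrossing_def
  proof (intro allI impI notI)
    fix x y z w
    assume e: "{x, y} \<in> {e \<in> insert {a, b} (power_graph_edges G). \<one> \<notin> e}"
      "{z, w} \<in> {e \<in> insert {a, b} (power_graph_edges G). \<one> \<notin> e}"
      and *: "layout x < layout z \<and> layout z < layout y \<and> layout y < layout w"
    have "crossing (layout x, layout y) (layout z, layout w)" using * by (simp add: crossing_def)
    moreover have "layout x < layout y" "layout z < layout w" using * by auto
    ultimately show False using nc'[OF int[OF e(1)] int[OF e(2)]] by simp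
  qed
qed

end

text \<open>Plane and line are equinumerous, and \<open>arctan\<close> compresses the line. Composed
  with the vertex placement of a given drawing, this yields the coordinates
  \<open>\<iota>\<close>.\<close>

lemma obtain_inj_complex_unit:
  obtains f :: "complex \<Rightarrow> real" where "inj f" "\<And>z. 0 < f z \<and> f z < 1"
proof -
  have "\<exists>h. bij_betw h (UNIV \<times> UNIV :: (real \<times> real) set) (UNIV :: real set)"
    using card_of_Times_same_infinite[of "UNIV :: real set"] card_of_ordIso infinite_UNIV_char_0 by blast
  then obtain h :: "real \<times> real \<Rightarrow> real" where h: "inj h" by (auto simp: bij_betw_def)
  define f where "f z = arctan (h (Re z, Im z)) / pi + 1 / 2" for z
  have "inj f"
    by (rule injI) (use h in \<open>auto simp: f_def arctan_eq_iff complex_eq_iff dest!: injD\<close>)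
  moreover have "0 < f z \<and> f z < 1" for z
    using arctan_lbound[of "h (Re z, Im z)"] arctan_ubound[of "h (Re z, Im z)"] by (simp add: f_def field_simps)
  ultimately show thesis using that by blast
qed

section \<open>Adding an edge to a planar power graph\<close>

context group
begin

lemma neq_one_if_ord: "ord x \<noteq> 1 \<Longrightarrow> x \<noteq> \<one>"
  using ord_id by metis

lemma planar_power_graph_ord:
  assumes "planar (carrier G) (power_graph_edges G)" "x \<in> carrier G"
  shows "ord x \<in> {1, 2, 3, 4}"
proof (rule ccontr)
  assume "ord x \<notin> {1, 2, 3, 4}"
  then obtain a b d u w where K: "distinct [a, b, d, u, w]"
    "\<forall>y\<in>{a, b, d, u, w}. \<forall>z\<in>{a, b, d, u, w}. y \<noteq> z \<longrightarrow> {y, z} \<in> power_graph_edges G"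
    using power_graph_K5[OF assms(2)] by metis
  obtain p c where "plane_drawing (carrier G) (power_graph_edges G) p c"
    using assms(1) by (auto simp: planar_def)
  then interpret plane_graph "carrier G" "power_graph_edges G" p c
    using simple_graph_power_graph by unfold_locales
  show False using no_K5[OF K(1)] K(2) by blast
qed

lemma planar_power_graph_countable_order_4:
  assumes "planar (carrier G) (power_graph_edges G)"
  shows "countable {x \<in> carrier G. ord x = 4}"
proof -
  obtain p c where "plane_drawing (carrier G) (power_graph_edges G) p c"
    using assms by (auto simp: planar_def)
  then interpret plane_graph "carrier G" "power_graph_edges G" p c
    using simple_graph_power_graph by unfold_locales
  define \<T> where "\<T> = {{x, y, z} | x y z. {x, y} \<in> power_graph_edges G \<and> {y, z} \<in> power_graph_edges G \<and>
    {x, z} \<in> power_graph_edges G \<and> \<one> \<notin> {x, y, z}}"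
  have "countable \<T>"
    unfolding \<T>_def by (rule countable_triangles) (auto intro: one_edge)
  moreover have "countable t" if "t \<in> \<T>" for t using that by (auto simp: \<T>_def)
  ultimately have "countable (\<Union>t\<in>\<T>. t)" by (rule countable_UN)
  then have "countable (\<Union>\<T>)" by simp
  moreover have "{x \<in> carrier G. ord x = 4} \<subseteq> \<Union>\<T>"
  proof
    fix x assume "x \<in> {x \<in> carrier G. ord x = 4}"
    then have x: "x \<in> carrier G" "ord x = 4" by auto
    have "\<one> \<notin> {x, inv x, x \<otimes> x}"
      using x square_order_4(1)[OF x] neq_one_if_ord[of x] neq_one_if_ord[of "x \<otimes> x"]
      by (auto simp: eq_commute[of \<one>])
    then have "{x, inv x, x \<otimes> x} \<in> \<T>" unfolding \<T>_def using order_4_edges[OF x] by blast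
    then show "x \<in> \<Union>\<T>" by blast
  qed
  ultimately show ?thesis using countable_subset by blast
qed

lemma planar_power_graph_inj_real:
  assumes "planar (carrier G) (power_graph_edges G)"
  obtains \<iota> :: "'a \<Rightarrow> real" where "inj_on \<iota> (carrier G)" "\<And>x. 0 < \<iota> x \<and> \<iota> x < 1"
proof -
  obtain p c where "plane_drawing (carrier G) (power_graph_edges G) p c"
    using assms by (auto simp: planar_def)
  then have p: "inj_on p (carrier G)" by (simp add: plane_drawing_def)
  obtain f :: "complex \<Rightarrow> real" where f: "inj f" "\<And>z. 0 < f z \<and> f z < 1"
    using obtain_inj_complex_unit by blast
  show thesis
  proof (rule that[of "f \<circ> p"])
    show "inj_on (f \<circ> p) (carrier G)" using p f(1) by (meson comp_inj_on inj_on_subset subset_UNIV)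
  qed (simp add: f(2))
qed

lemma planar_insert_involutions:
  assumes pl: "planar (carrier G) (power_graph_edges G)"
    and z: "z \<in> carrier G" "ord z = 2" "z' \<in> carrier G" "ord z' = 2" "z \<noteq> z'"
  shows "planar (carrier G) (insert {z, z'} (power_graph_edges G))"
proof -
  let ?F = "{x \<in> carrier G. ord x = 4}"
  \<comment> \<open>\<open>z\<close> and \<open>z'\<close> need not be squares but have to become
    centres. All involutions together may be uncountable and could not be numbered.\<close>
  define K where "K = (\<lambda>x. x \<otimes> x) ` ?F \<union> {z, z'}"
  have F: "countable ?F" by (rule planar_power_graph_countable_order_4[OF pl])
  then have K: "countable K" by (simp add: K_def)
  obtain \<iota> :: "'a \<Rightarrow> real" where \<iota>: "inj_on \<iota> (carrier G)" "\<And>x. 0 < \<iota> x \<and> \<iota> x < 1"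
    using planar_power_graph_inj_real[OF pl] by blast
  interpret power_graph_layout G \<iota> K "to_nat_on K" "to_nat_on ?F"
  proof
    show "ord x \<in> {1, 2, 3, 4}" if "x \<in> carrier G" for x using planar_power_graph_ord[OF pl that] .
    show "0 < \<iota> x \<and> \<iota> x < 4" for x using \<iota>(2)[of x] by simp
    show "K \<subseteq> {x \<in> carrier G. ord x = 2}" using z square_order_4(1) by (auto simp: K_def)
    show "inj_on (to_nat_on K) K" by (rule inj_on_to_nat_on[OF K])
    show "inj_on (to_nat_on ?F) ?F" by (rule inj_on_to_nat_on[OF F])
    show "x \<otimes> x \<in> K" if "x \<in> carrier G" "ord x = 4" for x using that by (auto simp: K_def)
  qed (rule \<iota>(1))
  have zK: "z \<in> K" "z' \<in> K" by (auto simp: K_def)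
  have l: "layout z = 5 + real (to_nat_on K z)" "layout z' = 5 + real (to_nat_on K z')"
    using z zK by (simp_all add: layout_def)
  have n1: "z \<noteq> \<one>" "z' \<noteq> \<one>" using z neq_one_if_ord by auto
  have "layout z \<noteq> layout z'" using inj_on_eq_iff[OF inj_layout, of z z'] z n1 by blast
  have "planar (carrier G) (insert {a, b} (power_graph_edges G))"
    if ab: "layout a < layout b" "a \<in> {z, z'}" "b \<in> {z, z'}" for a b
  proof (rule planar_insert_edge)
    show "a \<in> carrier G - {\<one>}" "b \<in> carrier G - {\<one>}" using that z n1 by auto
    have centre: "\<exists>k. layout w = 5 + real k" if "w \<in> {z, z'}" for w using that l by blast
    obtain k where "layout a = 5 + real k" using centre[OF ab(2)] by blast
    moreover obtain k' where "layout b = 5 + real k'" using centre[OF ab(3)] by blast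
    ultimately show "\<not> crossing i (layout a, layout b) \<and> \<not> crossing (layout a, layout b) i"
      if "i \<in> edge_intervals thirds fourths" for i
      using edge_intervals_not_crossing_centres[OF thirds_range that] by simp
  qed (rule ab(1))
  note main = this
  consider "layout z < layout z'" | "layout z' < layout z" using \<open>layout z \<noteq> layout z'\<close> by linarith
  then show ?thesis
    using main[of z z'] main[of z' z] by cases (simp_all add: insert_commute)
qed

lemma planar_insert_order_3:
  assumes pl: "planar (carrier G) (power_graph_edges G)"
    and a: "a \<in> carrier G" "ord a = 3" and b: "b \<in> carrier G" "ord b = 3" "b \<noteq> a" "b \<noteq> inv a"
  shows "planar (carrier G) (insert {b, a} (power_graph_edges G))"
proof -
  let ?F = "{x \<in> carrier G. ord x = 4}"
  define K where "K = (\<lambda>x. x \<otimes> x) ` ?F"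
  have F: "countable ?F" by (rule planar_power_graph_countable_order_4[OF pl])
  then have K: "countable K" by (simp add: K_def)
  obtain \<iota>\<^sub>0 :: "'a \<Rightarrow> real" where \<iota>\<^sub>0: "inj_on \<iota>\<^sub>0 (carrier G)" "\<And>x. 0 < \<iota>\<^sub>0 x \<and> \<iota>\<^sub>0 x < 1"
    using planar_power_graph_inj_real[OF pl] by blast
  \<comment> \<open>The pairs of \<open>a\<close> and \<open>b\<close> get the radii 2 and 3 while
    all others stay below 1, so no radius lies between. The larger value also puts \<open>a\<close>
    and \<open>b\<close>, rather than their inverses, on the negative side.\<close>
  define \<iota> where "\<iota> = \<iota>\<^sub>0(a := 2, b := 3)"
  have \<iota>_ab: "\<iota> a = 2" "\<iota> b = 3" "\<And>x. x \<noteq> a \<Longrightarrow> x \<noteq> b \<Longrightarrow> \<iota> x = \<iota>\<^sub>0 x" using b by (auto simp: \<iota>_def)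
  have \<iota>_lt: "0 < \<iota> x \<and> \<iota> x < 1" if "x \<noteq> a" "x \<noteq> b" for x using \<iota>_ab(3)[OF that] \<iota>\<^sub>0(2)[of x] by simp
  interpret power_graph_layout G \<iota> K "to_nat_on K" "to_nat_on ?F"
  proof
    show "ord x \<in> {1, 2, 3, 4}" if "x \<in> carrier G" for x using planar_power_graph_ord[OF pl that] .
    show "inj_on \<iota> (carrier G)"
    proof (rule inj_onI)
      fix x y assume xy: "x \<in> carrier G" "y \<in> carrier G" "\<iota> x = \<iota> y"
      show "x = y"
      proof (cases "x \<in> {a, b} \<or> y \<in> {a, b}")
        case True
        then show ?thesis using xy(3) \<iota>_ab(1,2) \<iota>_lt[of x] \<iota>_lt[of y] by (cases "x = a"; cases "x = b"; cases "y = a"; cases "y = b"; simp)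
      next
        case False
        then show ?thesis using xy \<iota>_ab(3) inj_on_eq_iff[OF \<iota>\<^sub>0(1), of x y] by simp
      qed
    qed
    show "0 < \<iota> x \<and> \<iota> x < 4" for x using \<iota>_lt[of x] \<iota>_ab(1,2) by fastforce
    show "K \<subseteq> {x \<in> carrier G. ord x = 2}" using square_order_4(1) by (auto simp: K_def)
    show "inj_on (to_nat_on K) K" by (rule inj_on_to_nat_on[OF K])
    show "inj_on (to_nat_on ?F) ?F" by (rule inj_on_to_nat_on[OF F])
    show "x \<otimes> x \<in> K" if "x \<in> carrier G" "ord x = 4" for x using that by (auto simp: K_def)
  qed
  have inv_ne: "inv a \<noteq> a" "inv a \<noteq> b" "inv b \<noteq> b" "inv b \<noteq> a"
    using inv_order_3 a b by auto
  have \<tau>: "\<tau> a = 2" "\<tau> b = 3" "\<tau> x \<in> {2, 3} \<or> \<tau> x < 1" for x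
    using \<iota>_lt[of "inv a"] \<iota>_lt[of "inv b"] \<iota>_lt[of x] \<iota>_lt[of "inv x"] inv_ne \<iota>_ab(1,2)
    by (auto simp: \<tau>_def max_def)
  have l: "layout a = - 2" "layout b = - 3"
    using \<tau>(1,2) \<iota>_lt[of "inv a"] \<iota>_lt[of "inv b"] inv_ne a b \<iota>_ab(1,2) by (auto simp: layout_def)
  show ?thesis
  proof (rule planar_insert_edge)
    show "a \<in> carrier G - {\<one>}" "b \<in> carrier G - {\<one>}" using a b neq_one_if_ord by auto
    show "layout b < layout a" using l by simp
    fix i assume i: "i \<in> edge_intervals thirds fourths"
    have "\<not> (2 < t \<and> t < 3)" if "t \<in> thirds" for t
      using that \<tau>(3) by (auto simp: thirds_def) (smt (verit))
    then show "\<not> crossing i (layout b, layout a) \<and> \<not> crossing (layout b, layout a) i"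
      using edge_intervals_not_crossing_pairs[OF thirds_range i, of "(layout b, layout a)" 3 2] l by simp
  qed
qed

text \<open>The numbering decides which pairs are neighbours, so \<open>a\<close> and
  \<open>b\<close> themselves need not be joinable in this layout; they witness that there are two
  pairs. To contradict maximality, any non-adjacent \<open>x\<close> and \<open>y\<close> will
  do.\<close>

lemma planar_insert_order_4:
  assumes pl: "planar (carrier G) (power_graph_edges G)"
    and a: "a \<in> carrier G" "ord a = 4" and b: "b \<in> carrier G" "ord b = 4" "b \<noteq> a" "b \<noteq> inv a"
    and sq: "\<And>x. \<lbrakk>x \<in> carrier G; ord x = 4\<rbrakk> \<Longrightarrow> x \<otimes> x = a \<otimes> a"
  shows "\<exists>x y. x \<in> carrier G \<and> ord x = 4 \<and> y \<in> carrier G \<and> ord y = 4 \<and> y \<noteq> x \<and> y \<noteq> inv x \<and>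
    planar (carrier G) (insert {y, x} (power_graph_edges G))"
proof -
  let ?F = "{x \<in> carrier G. ord x = 4}"
  define K where "K = (\<lambda>x. x \<otimes> x) ` ?F"
  have F: "countable ?F" by (rule planar_power_graph_countable_order_4[OF pl])
  then have K: "countable K" by (simp add: K_def)
  obtain \<iota> :: "'a \<Rightarrow> real" where \<iota>: "inj_on \<iota> (carrier G)" "\<And>x. 0 < \<iota> x \<and> \<iota> x < 1"
    using planar_power_graph_inj_real[OF pl] by blast
  interpret power_graph_layout G \<iota> K "to_nat_on K" "to_nat_on ?F"
  proof
    show "ord x \<in> {1, 2, 3, 4}" if "x \<in> carrier G" for x using planar_power_graph_ord[OF pl that] .
    show "0 < \<iota> x \<and> \<iota> x < 4" for x using \<iota>(2)[of x] by simp
    show "K \<subseteq> {x \<in> carrier G. ord x = 2}" using square_order_4(1) by (auto simp: K_def)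
    show "inj_on (to_nat_on K) K" by (rule inj_on_to_nat_on[OF K])
    show "inj_on (to_nat_on ?F) ?F" by (rule inj_on_to_nat_on[OF F])
    show "x \<otimes> x \<in> K" if "x \<in> carrier G" "ord x = 4" for x using that by (auto simp: K_def)
  qed (rule \<iota>(1))
  let ?\<nu> = "to_nat_on ?F"
  define k where "k = to_nat_on K (a \<otimes> a)"
  \<comment> \<open>The pairs with the two least labels are neighbours; by \<open>sq\<close> all
    pairs lie in one block.\<close>
  obtain x0 where x0: "x0 \<in> ?F" "\<And>y. y \<in> ?F \<Longrightarrow> \<mu> x0 \<le> \<mu> y"
    using ex_has_least_nat[of "\<lambda>x. x \<in> ?F" a \<mu>] a by blast
  have "\<exists>y. y \<in> ?F \<and> \<mu> y \<noteq> \<mu> x0"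
  proof (rule ccontr)
    assume "\<not> ?thesis"
    then have "\<mu> a = \<mu> x0" "\<mu> b = \<mu> x0" using a b by auto
    then show False using \<mu>_eqD[of a b] a b by simp
  qed
  then obtain y0 where y0: "y0 \<in> ?F" "\<mu> y0 \<noteq> \<mu> x0"
    "\<And>y. y \<in> ?F \<Longrightarrow> \<mu> y \<noteq> \<mu> x0 \<Longrightarrow> \<mu> y0 \<le> \<mu> y"
    using ex_has_least_nat[of "\<lambda>y. y \<in> ?F \<and> \<mu> y \<noteq> \<mu> x0" _ \<mu>] by blast
  \<comment> \<open>From each pair the root that faces the other pair: the pair of \<open>x0\<close>
    has the smaller label and lies on the right, so \<open>x\<close> is its left root, with odd
    index, and \<open>y\<close> is the right root of the other.\<close>
  define x where "x = (if ?\<nu> (inv x0) < ?\<nu> x0 then x0 else inv x0)"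
  define y where "y = (if ?\<nu> y0 < ?\<nu> (inv y0) then y0 else inv y0)"
  have x: "x \<in> carrier G" "ord x = 4" "\<mu> x = \<mu> x0" "?\<nu> (inv x) < ?\<nu> x"
    using x0(1) \<mu>_inv[of x0] \<nu>_inv_neq[of x0] by (auto simp: x_def)
  have y: "y \<in> carrier G" "ord y = 4" "\<mu> y = \<mu> y0" "?\<nu> y < ?\<nu> (inv y)"
    using y0(1) \<mu>_inv[of y0] \<nu>_inv_neq[of y0] by (auto simp: y_def)
  have lx: "layout x = root_pos k (2 * \<mu> x0 + 1)"
    using layout_order_4(3)[OF x(1,2,4)] x(3) sq[OF x(1,2)] by (simp add: k_def)
  have ly: "layout y = root_pos k (2 * \<mu> y0)"
    using layout_order_4(2)[OF y(1,2,4)] y(3) sq[OF y(1,2)] by (simp add: k_def)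
  have lt: "\<mu> x0 < \<mu> y0" using x0(2)[OF y0(1)] y0(2) by simp
  have "planar (carrier G) (insert {y, x} (power_graph_edges G))"
  proof (rule planar_insert_edge)
    show "x \<in> carrier G - {\<one>}" "y \<in> carrier G - {\<one>}" using x y neq_one_if_ord by auto
    show "layout y < layout x" unfolding lx ly using lt by (simp add: root_pos_less_iff)
    fix i assume i: "i \<in> edge_intervals thirds fourths"
    have "\<not> (\<mu> x0 < n \<and> n < \<mu> y0)" if n: "(k', n) \<in> fourths" for k' n
    proof -
      obtain g where "g \<in> ?F" "n = \<mu> g" using n unfolding fourths_def by blast
      then show ?thesis using y0(3)[of g] by auto
    qed
    then show "\<not> crossing i (layout y, layout x) \<and> \<not> crossing (layout y, layout x) i"
      using edge_intervals_not_crossing_blades[OF thirds_range i _ lt, of "(layout y, layout x)" k] lx ly by simp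
  qed
  moreover have "y \<noteq> x" "y \<noteq> inv x" using x y y0(2) \<mu>_inv[OF x(1)] by auto
  ultimately show ?thesis using x y by blast
qed

section \<open>Groups whose power graph leaves nothing to add\<close>

lemma no_order_3_if_unique_involution:
  assumes ords: "\<And>x. x \<in> carrier G \<Longrightarrow> ord x \<in> {1, 2, 3, 4}"
    and z: "z \<in> carrier G" "ord z = 2" "\<And>y. \<lbrakk>y \<in> carrier G; ord y = 2\<rbrakk> \<Longrightarrow> y = z"
    and x: "x \<in> carrier G"
  shows "ord x \<noteq> 3"
proof
  assume x3: "ord x = 3"
  have "z [^] (2::nat) = \<one>" using pow_eq_id[OF z(1), of 2] z(2) by simp
  then have zz: "z \<otimes> z = \<one>" using z(1) by (simp add: numeral_2_eq_2)
  have z1: "z \<noteq> \<one>" using neq_one_if_ord[of z] z(2) by simp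
  \<comment> \<open>A conjugate of an involution is an involution, so by uniqueness \<open>z\<close>
    commutes with \<open>x\<close>, and \<open>z \<otimes> x\<close> would have order 6.\<close>
  let ?y = "x \<otimes> z \<otimes> inv x"
  have y: "?y \<in> carrier G" and yx: "?y \<otimes> x = x \<otimes> z" using x z(1) by (simp_all add: m_assoc)
  have "?y \<otimes> ?y = ?y \<otimes> (x \<otimes> (z \<otimes> inv x))" using x z(1) by (simp add: m_assoc)
  also have "\<dots> = ?y \<otimes> x \<otimes> (z \<otimes> inv x)" using m_assoc[OF y x, of "z \<otimes> inv x"] x z(1) by simp
  also have "\<dots> = x \<otimes> (z \<otimes> z) \<otimes> inv x" unfolding yx using x z(1) by (simp add: m_assoc)
  finally have "?y \<otimes> ?y = \<one>" using x zz by simp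
  then have "?y [^] (2::nat) = \<one>" using y by (simp add: numeral_2_eq_2)
  then have "ord ?y dvd 2" using pow_eq_id[OF y] by simp
  moreover have "ord ?y \<noteq> 1"
  proof
    assume "ord ?y = 1"
    then have "?y = \<one>" using ord_eq_1[OF y] by simp
    then have "x \<otimes> z = x \<otimes> \<one>" using yx x by simp
    then show False using z1 x z(1) by simp
  qed
  ultimately have "ord ?y = 2" using two_is_prime_nat prime_nat_iff by blast
  then have "?y = z" by (rule z(3)[OF y])
  then have comm: "z \<otimes> x = x \<otimes> z" using yx by simp
  have pow: "(z \<otimes> x) [^] n = z [^] n \<otimes> x [^] n" for n :: nat
    using pow_mult_distrib[OF comm z(1) x] .
  have "(z \<otimes> x) [^] (4::nat) \<noteq> \<one>"
  proof -
    have "z [^] (4::nat) = \<one>" using pow_eq_id[OF z(1), of 4] z(2) by simp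
    moreover have "x [^] (4::nat) \<noteq> \<one>" using pow_eq_id[OF x, of 4] x3 by simp
    ultimately show ?thesis using pow x by simp
  qed
  moreover have "(z \<otimes> x) [^] (3::nat) \<noteq> \<one>"
  proof -
    have "z [^] (3::nat) \<noteq> \<one>" using pow_eq_id[OF z(1), of 3] z(2) by simp
    moreover have "x [^] (3::nat) = \<one>" using pow_eq_id[OF x, of 3] x3 by simp
    ultimately show ?thesis using pow z(1) by simp
  qed
  \<comment> \<open>Every admissible order divides 4 or 3, so these two exponents suffice.\<close>
  ultimately have "\<not> ord (z \<otimes> x) dvd 4" "\<not> ord (z \<otimes> x) dvd 3"
    using pow_eq_id[of "z \<otimes> x"] x z(1) by simp_all
  then show False using ords[of "z \<otimes> x"] x z(1) by auto
qed

text \<open>A second involution, or a second inverse pair of order 3 or 4, allows an edge to be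
  added; by maximality it is already present, against \<open>nonidentity_edge_cases\<close>. Without
  involutions this leaves order 1 or 3, with one involution order 2 or 4.\<close>

lemma maximal_planar_power_graph_imp_cyclic:
  assumes mp: "maximal_planar (carrier G) (power_graph_edges G)"
  shows "cyclic_group G \<and> finite (carrier G) \<and> order G \<le> 4"
proof -
  have pl: "planar (carrier G) (power_graph_edges G)" using mp by (simp add: maximal_planar_def)
  have edge: "{x, y} \<in> power_graph_edges G"
    if "x \<in> carrier G" "y \<in> carrier G" "x \<noteq> y" "planar (carrier G) (insert {x, y} (power_graph_edges G))" for x y
    using mp that by (auto simp: maximal_planar_def)
  note ords = planar_power_graph_ord[OF pl]
  \<comment> \<open>Serves all surviving groups at once, as the listed elements may
    coincide.\<close>
  have small: ?thesis if "g \<in> carrier G" "carrier G \<subseteq> {\<one>, g, inv g, g \<otimes> g}" for g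
  proof -
    have "\<one> = g [^] (0::int)" "g = g [^] (1::int)" using that(1) by simp_all
    moreover note inv_eq_pow[OF that(1)] square_eq_pow[OF that(1)]
    ultimately have "{\<one>, g, inv g, g \<otimes> g} \<subseteq> range (\<lambda>n::int. g [^] n)" by blast
    with that(2) have "carrier G \<subseteq> range (\<lambda>n::int. g [^] n)" by (rule order_trans)
    then have "cyclic_group G" using cyclic_groupI that(1) by blast
    moreover have fin: "finite (carrier G)" using that(2) finite_subset by blast
    moreover have "card (carrier G) \<le> card {\<one>, g, inv g, g \<otimes> g}" using that(2) by (intro card_mono) auto
    then have "order G \<le> 4"
      using card_length[of "[\<one>, g, inv g, g \<otimes> g]"] by (simp add: order_def)
    ultimately show ?thesis by blast
  qed
  have one: "x = \<one>" if "x \<in> carrier G" "ord x = 1" for x using that ord_eq_1 by blast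
  show ?thesis
  proof (cases "\<exists>z\<in>carrier G. ord z = 2")
    case False
    \<comment> \<open>Order 4 is excluded too, since its squares would be involutions.\<close>
    then have three: "x = \<one> \<or> ord x = 3" if "x \<in> carrier G" for x
      using ords[OF that] one[OF that] square_order_4(1)[OF that] that by auto
    show ?thesis
    proof (cases "carrier G \<subseteq> {\<one>}")
      case True
      then show ?thesis by (intro small[of \<one>]) auto
    next
      case False
      then obtain a where a: "a \<in> carrier G" "ord a = 3" using three by blast
      have "b \<in> {\<one>, a, inv a}" if b: "b \<in> carrier G" for b
      proof (rule ccontr)
        assume n: "b \<notin> {\<one>, a, inv a}"
        then have b3: "ord b = 3" using three[OF b] by simp
        have "{b, a} \<in> power_graph_edges G"
          using n planar_insert_order_3[OF pl a b b3] by (intro edge) (use a b in auto)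
        then show False
          using nonidentity_edge_cases[OF ords, of b a] n b3 a b neq_one_if_ord[of a] square_order_4(1) by auto
      qed
      then show ?thesis using a by (intro small[of a]) auto
    qed
  next
    case True
    then obtain z where z: "z \<in> carrier G" "ord z = 2" by blast
    have unique: "y = z" if "y \<in> carrier G" "ord y = 2" for y
    proof (rule ccontr)
      assume "y \<noteq> z"
      then have "{y, z} \<in> power_graph_edges G"
        using planar_insert_involutions[OF pl that z] that z by (intro edge) auto
      then show False
        using nonidentity_edge_cases[OF ords, of y z] that z neq_one_if_ord[of y] neq_one_if_ord[of z] by auto
    qed
    have four: "x \<in> {\<one>, z} \<or> ord x = 4" if "x \<in> carrier G" for x
    proof -
      have "ord x \<noteq> 3" by (rule no_order_3_if_unique_involution[OF ords z unique that])
      then show ?thesis using ords[OF that] one[OF that] unique[OF that] by blast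
    qed
    have sq: "x \<otimes> x = z" if "x \<in> carrier G" "ord x = 4" for x
      using unique square_order_4(1)[OF that] that by simp
    show ?thesis
    proof (cases "\<exists>a\<in>carrier G. ord a = 4")
      case False
      then show ?thesis using four z(1) by (intro small[of z]) blast+
    next
      case True
      then obtain a where a: "a \<in> carrier G" "ord a = 4" by blast
      have "b \<in> {a, inv a}" if b: "b \<in> carrier G" "ord b = 4" for b
      proof (rule ccontr)
        assume "b \<notin> {a, inv a}"
        then have "b \<noteq> a" "b \<noteq> inv a" by auto
        then obtain x y where xy: "x \<in> carrier G" "ord x = 4" "y \<in> carrier G" "ord y = 4"
          "y \<noteq> x" "y \<noteq> inv x" "planar (carrier G) (insert {y, x} (power_graph_edges G))"
          using planar_insert_order_4[OF pl a b] sq sq[OF a] by metis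
        then have "{y, x} \<in> power_graph_edges G" by (intro edge) auto
        then show False
          using nonidentity_edge_cases[OF ords, of y x] xy sq z neq_one_if_ord[of x] neq_one_if_ord[of y] by auto
      qed
      then have "carrier G \<subseteq> {\<one>, a, inv a, a \<otimes> a}" using four sq[OF a] by blast
      then show ?thesis using a by (intro small[of a])
    qed
  qed
qed

end

theorem theorem2p14:
  fixes G :: "('a, 'b) monoid_scheme"
  assumes "group G"
  shows "maximal_planar (carrier G) (power_graph_edges G) \<longleftrightarrow>
         cyclic_group G \<and> finite (carrier G) \<and> order G \<le> 4"
proof
  interpret group G by fact
  assume "maximal_planar (carrier G) (power_graph_edges G)"
  then show "cyclic_group G \<and> finite (carrier G) \<and> order G \<le> 4"
    by (rule maximal_planar_power_graph_imp_cyclic)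
next
  interpret group G by fact
  assume *: "cyclic_group G \<and> finite (carrier G) \<and> order G \<le> 4"
  then have "planar (carrier G) (power_graph_edges G)"
    by (intro planar_card_le_4 simple_graph_power_graph) (auto simp: order_def)
  \<comment> \<open>The graph is complete, so there is no edge to add.\<close>
  then show "maximal_planar (carrier G) (power_graph_edges G)"
    using * power_graph_complete_cyclic by (auto simp: maximal_planar_def)
qed

end
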